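(* Let $\Omega\subset\mathbb{C}^d$ be a (possibly unbounded) Kobayashi hyperbolic local Gromov model domain that is hyperbolically embedded in $\mathbb{C}^d$. Let $\xi\in\partial\Omega$ and let $\gamma,\sigma:[0,\infty)\to\Omega$ be $\mathsf{k}_\Omega$-geodesic rays that land at $\xi$. Then $\gamma$ and $\sigma$ are $\mathsf{k}_\Omega$-asymptotic, i.e., $$\sup_{t\in[0,\infty)}\mathsf{k}_\Omega(\gamma(t),\sigma(t))<\infty.$$
   Context: For a domain $\Omega\subset\mathbb{C}^d$, $\mathsf{k}_\Omega$ denotes the Kobayashi (pseudo)distance; $\Omega$ is (Kobayashi) hyperbolic if $\mathsf{k}_\Omega$ is a distance, and complete (Kobayashi) hyperbolic if moreover $(\Omega,\mathsf{k}_\Omega)$ is complete (then it is a proper geodesic space). $\overline{\Omega}$ and $\partial\Omega$ are the Euclidean closure and boundary in $\mathbb{C}^d$. A geodesic ray in a distance space $(X,d)$ is an isometric embedding $[0,\infty)\to X$; a $\mathsf{k}_\Omega$-geodesic ray is a geodesic ray in $(\Omega,\mathsf{k}_\Omega)$. It lands at $\xi\in\partial\Omega$ if $\lim_{t\to\infty}\gamma(t)=\xi$ (in the Euclidean topology). For a proper geodesic Gromov hyperbolic space $(X,d)$, the Gromov boundary $\partial^G X$ is the set of equivalence classes of geodesic rays, where $\gamma\sim\sigma$ iff $\sup_{t\ge0}d(\gamma(t),\sigma(t))<\infty$. The Gromov compactification $\overline{X}^G=X\sqcup\partial^G X$ carries its usual metrizable compact topology: a sequence $(x_n)\subset X$ converges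 to $\xi\in\partial^G X$ iff there is $p\in X$ such that, for every choice of geodesic segments $\gamma_n$ joining $p$ to $x_n$, every subsequence of $(\gamma_n)$ has a further subsequence converging uniformly on compact subsets of $[0,\infty)$ to a geodesic ray representing $\xi$; similarly, $(\xi_n)\subset\partial^G X$ converges to $\xi\in\partial^G X$ iff there is $p\in X$ such that the same holds for every choice of geodesic rays $\gamma_n$ emanating from $p$ and representing $\xi_n$. A (possibly unbounded) hyperbolic domain $\Omega\subset\mathbb{C}^d$ is a local Gromov model domain if for every $\xi\in\partial\Omega$ there is a bounded neighbourhood $U$ of $\xi$ such that $U\cap\Omega$ is connected, complete Kobayashi hyperbolic, Gromov hyperbolic relative to its Kobayashi distance $\mathsf{k}_{U\cap\Omega}$, and such that the identity map of $U\cap\Omega$ extends to a homeomorphism from the Gromov compactification $\overline{U\cap\Omega}^G$ of $(U\cap\Omega,\mathsf{k}_{U\cap\Omega})$ to the Euclidean closure $\overline{U\cap\Omega}$. $\Omega$ is hyperbolically embedded in $\mathbb{C}^d$ if for all $p,q\in\partial\Omega$ with $p\neq q$, $\liminf_{(x,y)\to(p,q),\ x,y\in\Omega}\mathsf{k}_\Omega(x,y)>0$. *)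

theory Defs
  imports "HOL-Analysis.Analysis"
begin

section \<open>The Kobayashi pseudodistance\<close>

text \<open>The Poincare distance of the unit disc, normalised to have curvature \<open>-4\<close>.\<close>

definition poincare_dist :: "complex \<Rightarrow> complex \<Rightarrow> real" where
  "poincare_dist a b = artanh (cmod ((a - b) / (1 - cnj b * a)))"

definition holomorphic_disc :: "(complex ^ 'n) set \<Rightarrow> (complex \<Rightarrow> complex ^ 'n) \<Rightarrow> bool" where
  "holomorphic_disc \<Omega> f \<longleftrightarrow>
     (\<forall>i. (\<lambda>z. f z $ i) holomorphic_on ball 0 1) \<and> f ` ball 0 1 \<subseteq> \<Omega>"

text \<open>The infimum of the lengths of the finite chains of holomorphic discs joining \<open>x\<close> to \<open>y\<close>.
  If \<open>\<Omega>\<close> is open and connected, such chains exist for all \<open>x, y \<in> \<Omega>\<close>, so that \<^const>\<open>Inf\<close> is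
  taken over a nonempty set of nonnegative reals; nothing is claimed for other sets \<open>\<Omega>\<close>.
  The value \<open>0\<close> outside \<open>\<Omega>\<close> is a dummy: \<^locale>\<open>Metric_space\<close> asks for symmetry and
  nonnegativity on the whole type.\<close>

definition kobayashi_dist :: "(complex ^ 'n) set \<Rightarrow> complex ^ 'n \<Rightarrow> complex ^ 'n \<Rightarrow> real" where
  "kobayashi_dist \<Omega> x y =
     (if x \<in> \<Omega> \<and> y \<in> \<Omega> then
        Inf {(\<Sum>i<n. poincare_dist (a i) (b i)) | (n :: nat) p f a b.
               p 0 = x \<and> p n = y \<and>
               (\<forall>i<n. holomorphic_disc \<Omega> (f i) \<and> a i \<in> ball 0 1 \<and> b i \<in> ball 0 1 \<and>
                       f i (a i) = p i \<and> f i (b i) = p (Suc i))}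
      else 0)"

definition complex_domain :: "(complex ^ 'n) set \<Rightarrow> bool" where
  "complex_domain \<Omega> \<longleftrightarrow> open \<Omega> \<and> connected \<Omega> \<and> \<Omega> \<noteq> {}"

definition kobayashi_hyperbolic :: "(complex ^ 'n) set \<Rightarrow> bool" where
  "kobayashi_hyperbolic \<Omega> \<longleftrightarrow> Metric_space \<Omega> (kobayashi_dist \<Omega>)"

definition complete_kobayashi_hyperbolic :: "(complex ^ 'n) set \<Rightarrow> bool" where
  "complete_kobayashi_hyperbolic \<Omega> \<longleftrightarrow>
     kobayashi_hyperbolic \<Omega> \<and> Metric_space.mcomplete \<Omega> (kobayashi_dist \<Omega>)"

definition hyperbolically_embedded :: "(complex ^ 'n) set \<Rightarrow> bool" where
  "hyperbolically_embedded \<Omega> \<longleftrightarrow>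
     (\<forall>p \<in> frontier \<Omega>. \<forall>q \<in> frontier \<Omega>. p \<noteq> q \<longrightarrow>
        Liminf (at (p, q) within \<Omega> \<times> \<Omega>) (\<lambda>(x, y). ereal (kobayashi_dist \<Omega> x y)) > 0)"


section \<open>Gromov hyperbolicity and the Gromov compactification\<close>

text \<open>Below, \<open>(M, d)\<close> is a metric space with carrier \<open>M\<close>, as in \<^locale>\<open>Metric_space\<close>.
  Geodesics are total functions on the reals whose values at negative times are irrelevant.\<close>

definition geodesic_ray :: "'a set \<Rightarrow> ('a \<Rightarrow> 'a \<Rightarrow> real) \<Rightarrow> (real \<Rightarrow> 'a) \<Rightarrow> bool" where
  "geodesic_ray M d \<gamma> \<longleftrightarrow>
     \<gamma> ` {0..} \<subseteq> M \<and> (\<forall>s\<ge>0. \<forall>t\<ge>0. d (\<gamma> s) (\<gamma> t) = \<bar>s - t\<bar>)"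

text \<open>A geodesic segment is prolonged by its endpoint after time \<open>d p x\<close>. A sequence of
  prolonged segments whose lengths do not tend to infinity cannot converge to a ray.\<close>

definition geodesic_segment ::
    "'a set \<Rightarrow> ('a \<Rightarrow> 'a \<Rightarrow> real) \<Rightarrow> 'a \<Rightarrow> 'a \<Rightarrow> (real \<Rightarrow> 'a) \<Rightarrow> bool" where
  "geodesic_segment M d p x \<gamma> \<longleftrightarrow>
     \<gamma> ` {0..d p x} \<subseteq> M \<and> \<gamma> 0 = p \<and> \<gamma> (d p x) = x \<and>
     (\<forall>s\<in>{0..d p x}. \<forall>t\<in>{0..d p x}. d (\<gamma> s) (\<gamma> t) = \<bar>s - t\<bar>) \<and>
     (\<forall>t\<ge>d p x. \<gamma> t = x)"

definition gromov_product :: "('a \<Rightarrow> 'a \<Rightarrow> real) \<Rightarrow> 'a \<Rightarrow> 'a \<Rightarrow> 'a \<Rightarrow> real" where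
  "gromov_product d p x y = (d p x + d p y - d x y) / 2"

definition gromov_hyperbolic :: "'a set \<Rightarrow> ('a \<Rightarrow> 'a \<Rightarrow> real) \<Rightarrow> bool" where
  "gromov_hyperbolic M d \<longleftrightarrow>
     (\<exists>\<delta>\<ge>0. \<forall>p\<in>M. \<forall>x\<in>M. \<forall>y\<in>M. \<forall>z\<in>M.
        gromov_product d p x z \<ge> min (gromov_product d p x y) (gromov_product d p y z) - \<delta>)"

definition asymptotic_rays ::
    "'a set \<Rightarrow> ('a \<Rightarrow> 'a \<Rightarrow> real) \<Rightarrow> ((real \<Rightarrow> 'a) \<times> (real \<Rightarrow> 'a)) set" where
  "asymptotic_rays M d =
     {(\<gamma>, \<sigma>). geodesic_ray M d \<gamma> \<and> geodesic_ray M d \<sigma> \<and>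
              bdd_above ((\<lambda>t. d (\<gamma> t) (\<sigma> t)) ` {0..})}"

definition gromov_boundary ::
    "'a set \<Rightarrow> ('a \<Rightarrow> 'a \<Rightarrow> real) \<Rightarrow> (real \<Rightarrow> 'a) set set" where
  "gromov_boundary M d = {\<gamma>. geodesic_ray M d \<gamma>} // asymptotic_rays M d"

definition locally_uniform_limit ::
    "('a \<Rightarrow> 'a \<Rightarrow> real) \<Rightarrow> (nat \<Rightarrow> real \<Rightarrow> 'a) \<Rightarrow> (real \<Rightarrow> 'a) \<Rightarrow> bool" where
  "locally_uniform_limit d \<gamma> \<sigma> \<longleftrightarrow>
     (\<forall>R. \<forall>\<epsilon>>0. \<forall>\<^sub>F n in sequentially. \<forall>t\<in>{0..R}. d (\<gamma> n t) (\<sigma> t) < \<epsilon>)"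

definition subconverges_to ::
    "('a \<Rightarrow> 'a \<Rightarrow> real) \<Rightarrow> (nat \<Rightarrow> real \<Rightarrow> 'a) \<Rightarrow> (real \<Rightarrow> 'a) set \<Rightarrow> bool" where
  "subconverges_to d \<gamma> \<xi> \<longleftrightarrow>
     (\<forall>r :: nat \<Rightarrow> nat. strict_mono r \<longrightarrow>
        (\<exists>s :: nat \<Rightarrow> nat. strict_mono s \<and>
           (\<exists>\<sigma>\<in>\<xi>. locally_uniform_limit d (\<gamma> \<circ> r \<circ> s) \<sigma>)))"

definition points_tendsto_boundary ::
    "'a set \<Rightarrow> ('a \<Rightarrow> 'a \<Rightarrow> real) \<Rightarrow> (nat \<Rightarrow> 'a) \<Rightarrow> (real \<Rightarrow> 'a) set \<Rightarrow> bool" where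
  "points_tendsto_boundary M d x \<xi> \<longleftrightarrow>
     (\<exists>p\<in>M. \<forall>\<gamma>. (\<forall>n. geodesic_segment M d p (x n) (\<gamma> n)) \<longrightarrow> subconverges_to d \<gamma> \<xi>)"

definition boundary_tendsto_boundary ::
    "'a set \<Rightarrow> ('a \<Rightarrow> 'a \<Rightarrow> real) \<Rightarrow> (nat \<Rightarrow> (real \<Rightarrow> 'a) set) \<Rightarrow> (real \<Rightarrow> 'a) set \<Rightarrow> bool" where
  "boundary_tendsto_boundary M d \<eta> \<xi> \<longleftrightarrow>
     (\<exists>p\<in>M. \<forall>\<gamma>. (\<forall>n. \<gamma> n \<in> \<eta> n \<and> \<gamma> n 0 = p) \<longrightarrow> subconverges_to d \<gamma> \<xi>)"

text \<open>The topology of the Gromov compactification is metrizable, hence its open sets are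
  exactly the sequentially open ones. As \<open>M\<close> is open in it and carries the topology of \<open>d\<close>, it
  is enough to test sequences of points of \<open>M\<close> and sequences of boundary points that converge
  to a boundary point.\<close>

definition gromov_open ::
    "'a set \<Rightarrow> ('a \<Rightarrow> 'a \<Rightarrow> real) \<Rightarrow> ('a + (real \<Rightarrow> 'a) set) set \<Rightarrow> bool" where
  "gromov_open M d W \<longleftrightarrow>
     W \<subseteq> M <+> gromov_boundary M d \<and>
     openin (Metric_space.mtopology M d) (Inl -` W) \<and>
     (\<forall>\<xi>. Inr \<xi> \<in> W \<longrightarrow>
        (\<forall>x. range x \<subseteq> M \<and> points_tendsto_boundary M d x \<xi> \<longrightarrow>
             (\<forall>\<^sub>F n in sequentially. Inl (x n) \<in> W)) \<and>
        (\<forall>\<eta>. range \<eta> \<subseteq> gromov_boundary M d \<and> boundary_tendsto_boundary M d \<eta> \<xi> \<longrightarrow>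
             (\<forall>\<^sub>F n in sequentially. Inr (\<eta> n) \<in> W)))"

definition gromov_compactification ::
    "'a set \<Rightarrow> ('a \<Rightarrow> 'a \<Rightarrow> real) \<Rightarrow> ('a + (real \<Rightarrow> 'a) set) topology" where
  "gromov_compactification M d = topology (gromov_open M d)"

lemma istopology_gromov_open: "istopology (gromov_open M d)"
  unfolding istopology_def
proof (intro conjI allI impI)
  fix S T assume S: "gromov_open M d S" and T: "gromov_open M d T"
  show "gromov_open M d (S \<inter> T)"
    unfolding gromov_open_def
  proof (intro conjI allI impI)
    show "S \<inter> T \<subseteq> M <+> gromov_boundary M d"
      using S by (auto simp: gromov_open_def)
    show "openin (Metric_space.mtopology M d) (Inl -` (S \<inter> T))"
      using S T by (auto simp: gromov_open_def)
  qed (use S T in \<open>auto simp: gromov_open_def intro: eventually_conj\<close>)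
next
  fix \<K> assume \<K>: "\<forall>K\<in>\<K>. gromov_open M d K"
  show "gromov_open M d (\<Union>\<K>)"
    unfolding gromov_open_def
  proof (intro conjI allI impI)
    show "\<Union>\<K> \<subseteq> M <+> gromov_boundary M d"
      using \<K> by (auto simp: gromov_open_def)
    show "openin (Metric_space.mtopology M d) (Inl -` \<Union>\<K>)"
      using \<K> by (auto simp: gromov_open_def vimage_Union)
  next
    fix \<xi> x assume "Inr \<xi> \<in> \<Union>\<K>" and x: "range x \<subseteq> M \<and> points_tendsto_boundary M d x \<xi>"
    then obtain K where K: "K \<in> \<K>" "Inr \<xi> \<in> K" by blast
    then have "\<forall>\<^sub>F n in sequentially. Inl (x n) \<in> K"
      using \<K> x by (auto simp: gromov_open_def)
    then show "\<forall>\<^sub>F n in sequentially. Inl (x n) \<in> \<Union>\<K>"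
      by eventually_elim (use K in blast)
  next
    fix \<xi> \<eta> assume "Inr \<xi> \<in> \<Union>\<K>"
      and \<eta>: "range \<eta> \<subseteq> gromov_boundary M d \<and> boundary_tendsto_boundary M d \<eta> \<xi>"
    then obtain K where K: "K \<in> \<K>" "Inr \<xi> \<in> K" by blast
    then have "\<forall>\<^sub>F n in sequentially. Inr (\<eta> n) \<in> K"
      using \<K> \<eta> by (auto simp: gromov_open_def)
    then show "\<forall>\<^sub>F n in sequentially. Inr (\<eta> n) \<in> \<Union>\<K>"
      by eventually_elim (use K in blast)
  qed
qed

lemma openin_gromov_compactification:
  "openin (gromov_compactification M d) W \<longleftrightarrow> gromov_open M d W"
  by (simp add: gromov_compactification_def topology_inverse' istopology_gromov_open)

lemma topspace_gromov_compactification: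
  assumes "Metric_space M d"
  shows "topspace (gromov_compactification M d) = M <+> gromov_boundary M d"
proof -
  interpret Metric_space M d by fact
  have "Inl -` (M <+> gromov_boundary M d) = M" by auto
  then have "gromov_open M d (M <+> gromov_boundary M d)"
    by (auto simp: gromov_open_def intro!: always_eventually)
  then show ?thesis
    by (metis openin_gromov_compactification gromov_open_def openin_subset openin_topspace
        subset_antisym)
qed


section \<open>Local Gromov model domains\<close>

text \<open>The neighbourhood \<open>U\<close> can be taken open: only \<open>U \<inter> \<Omega>\<close>, which has to be a domain,
  matters, and it does not change when \<open>U\<close> is replaced by \<open>interior U \<union> (U \<inter> \<Omega>)\<close>.\<close>

definition local_gromov_model_domain :: "(complex ^ 'n) set \<Rightarrow> bool" where
  "local_gromov_model_domain \<Omega> \<longleftrightarrow>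
     complex_domain \<Omega> \<and> kobayashi_hyperbolic \<Omega> \<and>
     (\<forall>\<xi>\<in>frontier \<Omega>. \<exists>U. open U \<and> bounded U \<and> \<xi> \<in> U \<and>
        connected (U \<inter> \<Omega>) \<and>
        complete_kobayashi_hyperbolic (U \<inter> \<Omega>) \<and>
        gromov_hyperbolic (U \<inter> \<Omega>) (kobayashi_dist (U \<inter> \<Omega>)) \<and>
        (\<exists>\<Phi>. homeomorphic_map
                (gromov_compactification (U \<inter> \<Omega>) (kobayashi_dist (U \<inter> \<Omega>)))
                (top_of_set (closure (U \<inter> \<Omega>))) \<Phi> \<and>
              (\<forall>x\<in>U \<inter> \<Omega>. \<Phi> (Inl x) = x)))"

end

theory Submission
  imports Defs "HOL-Complex_Analysis.Riemann_Mapping" "HOL-Library.Diagonal_Subsequence" "HOL-Real_Asymp.Real_Asymp"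
begin

text \<open>
  Near \<open>\<xi>\<close> the domain \<open>\<Omega>\<close> looks like the Gromov hyperbolic piece \<open>X = U \<inter> \<Omega>\<close>, whose Gromov
  boundary is its Euclidean boundary; the theorem is transferred from \<open>X\<close> to \<open>\<Omega>\<close>.

  Inclusion decreases the Kobayashi distance, so that \<open>k\<^sub>\<Omega> \<le> k\<^sub>X\<close> on \<open>X\<close>. Conversely, a short disc in
  \<open>\<Omega>\<close> whose centre is \<open>k\<^sub>\<Omega>\<close>-far from \<open>\<Omega> - U\<close> becomes a disc in \<open>X\<close> when it is restricted to a
  smaller concentric disc, and this changes its length by a bounded factor at most. Hence \<open>k\<^sub>X\<close> is
  bounded by a multiple of \<open>k\<^sub>\<Omega>\<close> at small scale around such points
  (\<open>kobayashi_dist_localization\<close>), which is an integrated form of the localization lemma of Royden.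
  The tail of a \<open>k\<^sub>\<Omega>\<close>-geodesic ray landing at \<open>\<xi>\<close> stays far from \<open>\<Omega> - U\<close>
  (\<open>landing_ray_deep_in_neighbourhood\<close>): otherwise chains of discs whose lengths tend to \<open>0\<close> would
  lead from the ray to a small sphere around \<open>\<xi>\<close>. A limit point of their ends on the sphere cannot
  lie in \<open>\<Omega>\<close>, because the ray leaves every \<open>k\<^sub>\<Omega>\<close>-ball, nor on the boundary, because \<open>\<Omega>\<close> is
  hyperbolically embedded. So both tails are Lipschitz in \<open>(X, k\<^sub>X)\<close>, and as \<open>k\<^sub>\<Omega> \<le> k\<^sub>X\<close> they are
  quasi-geodesics of \<open>X\<close>.

  In a Gromov hyperbolic space, geodesics stay near quasi-geodesics with the same ends
  (\<open>geodesic_near_quasigeodesic\<close>). The geodesics joining the origin of such a tail to its far points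
  subconverge to a geodesic ray \<open>\<rho>\<close>, which is therefore at finite Hausdorff distance from the tail.
  The far points converge to the class of \<open>\<rho>\<close> in the Gromov compactification and to \<open>\<xi>\<close> in the
  closure, so that the homeomorphism \<open>\<Phi>\<close> between the two sends the class of \<open>\<rho>\<close> to \<open>\<xi>\<close>
  (\<open>quasigeodesic_shadows_ray\<close>). As \<open>\<Phi>\<close> is injective, the rays obtained from \<open>\<gamma>\<close> and from \<open>\<sigma>\<close>
  are asymptotic. Hence each point of the tail of \<open>\<gamma>\<close> is at bounded \<open>k\<^sub>X\<close>-distance from \<open>\<sigma>\<close>, a
  fortiori at bounded \<open>k\<^sub>\<Omega>\<close>-distance, and for geodesic rays this implies that they are asymptotic.

  The homeomorphism \<open>\<Phi>\<close> also yields that \<open>(X, k\<^sub>X)\<close> is geodesic and proper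
  (\<open>geodesic_segment_exists\<close>, \<open>bounded_sequence_subconverges\<close>).
\<close>


section \<open>Stability of quasi-geodesics in Gromov hyperbolic spaces\<close>

locale gromov_hyperbolic_space = Metric_space +
  fixes \<delta> :: real
  assumes delta_nonneg: "0 \<le> \<delta>"
    and four_point: "\<lbrakk>p \<in> M; x \<in> M; y \<in> M; z \<in> M\<rbrakk> \<Longrightarrow>
      min (gromov_product d p x y) (gromov_product d p y z) - \<delta> \<le> gromov_product d p x z"
begin

lemma gromov_product_ge:
  assumes "p \<in> M" "x \<in> M" "y \<in> M"
  shows "d p x - d x y \<le> gromov_product d p x y"
  using triangle[of p y x] assms by (simp add: gromov_product_def commute field_simps)

lemma gromov_product_commute: "gromov_product d p x y = gromov_product d p y x"
  by (simp add: gromov_product_def commute add.commute)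

text \<open>The four point inequality, iterated along a dyadic chain, loses \<open>\<delta>\<close> only for each halving: the loss
  is logarithmic in the number of points. This is the form in which hyperbolicity forces a path that
  avoids a large ball around \<open>p\<close> to be long.\<close>

lemma gromov_product_chain:
  assumes "p \<in> M" "\<And>i. i \<le> 2 ^ k \<Longrightarrow> y i \<in> M"
    and "\<And>i. i < 2 ^ k \<Longrightarrow> m \<le> gromov_product d p (y i) (y (Suc i))"
  shows "m - real k * \<delta> \<le> gromov_product d p (y 0) (y (2 ^ k))"
  using assms(2,3)
proof (induction k arbitrary: y)
  case 0
  then show ?case by simp
next
  case (Suc k)
  have "m - real k * \<delta> \<le> gromov_product d p (y 0) (y (2 ^ k))"
    by (rule Suc.IH) (use Suc.prems in auto)
  moreover have "m - real k * \<delta> \<le> gromov_product d p (y (2 ^ k + 0)) (y (2 ^ k + 2 ^ k))"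
  proof (rule Suc.IH[of "\<lambda>i. y (2 ^ k + i)"])
    show "m \<le> gromov_product d p (y (2 ^ k + i)) (y (2 ^ k + Suc i))" if "i < 2 ^ k" for i
      using Suc.prems(2)[of "2 ^ k + i"] that by simp
  qed (use Suc.prems(1) in auto)
  moreover have "min (gromov_product d p (y 0) (y (2 ^ k)))
      (gromov_product d p (y (2 ^ k)) (y (2 ^ Suc k))) - \<delta> \<le> gromov_product d p (y 0) (y (2 ^ Suc k))"
    by (rule four_point) (use assms(1) Suc.prems(1) in auto)
  ultimately show ?case by (simp add: algebra_simps mult_2)
qed

text \<open>Suppose that a point \<open>x = g u\<close> is further than \<open>D - 1\<close> from the path. Walk on the geodesic from
  \<open>x\<close> to distance \<open>2 * D\<close> on both sides (or up to its ends), and from there jump to the path; the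
  jumps have length at most \<open>D\<close>, so they also stay away from \<open>x\<close>. The part of the path between
  them connects points at distance at most \<open>6 * D\<close>, so \<open>2 ^ k \<ge> 6 * D\<close> steps of length at most \<open>L\<close>
  suffice for it. The chain inequality then bounds the Gromov product based at \<open>x\<close> of the two points
  on the geodesic from below; but this product is \<open>0\<close>, because \<open>x\<close> lies between them.\<close>

lemma geodesic_near_path_improve:
  assumes alpha: "\<And>t. 0 \<le> t \<Longrightarrow> \<alpha> t \<in> M"
    and upper: "\<And>s t. \<lbrakk>0 \<le> s; 0 \<le> t\<rbrakk> \<Longrightarrow> d (\<alpha> s) (\<alpha> t) \<le> L * \<bar>s - t\<bar>"
    and lower: "\<And>s t. \<lbrakk>0 \<le> s; 0 \<le> t\<rbrakk> \<Longrightarrow> \<bar>s - t\<bar> \<le> d (\<alpha> s) (\<alpha> t)"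
    and b: "0 \<le> b" and g: "geodesic_segment M d (\<alpha> 0) (\<alpha> b) g"
    and L: "0 \<le> L"
    and k: "6 * D \<le> 2 ^ k" and D: "1 + L + (real k + 2) * \<delta> < D"
    and near: "\<And>u. u \<in> {0..d (\<alpha> 0) (\<alpha> b)} \<Longrightarrow> \<exists>t\<in>{0..b}. d (g u) (\<alpha> t) \<le> D"
    and u: "u \<in> {0..d (\<alpha> 0) (\<alpha> b)}"
  shows "\<exists>t\<in>{0..b}. d (g u) (\<alpha> t) \<le> D - 1"
proof (rule ccontr)
  assume "\<not> ?thesis"
  then have far: "D - 1 < d (g u) (\<alpha> t)" if "t \<in> {0..b}" for t
    using that by force
  define l where "l = d (\<alpha> 0) (\<alpha> b)"
  have D0: "D > 1"
    using D L delta_nonneg by (smt (verit) mult_nonneg_nonneg of_nat_0_le_iff)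
  have gM: "g v \<in> M" if "v \<in> {0..l}" for v
    using g that by (auto simp: geodesic_segment_def l_def)
  have gd: "d (g v) (g w) = \<bar>v - w\<bar>" if "v \<in> {0..l}" "w \<in> {0..l}" for v w
    using g that by (auto simp: geodesic_segment_def l_def)
  have g0: "g 0 = \<alpha> 0" and gl: "g l = \<alpha> b"
    using g by (auto simp: geodesic_segment_def l_def)
  have ul: "u \<in> {0..l}" using u by (simp add: l_def)
  \<comment> \<open>At an end of the geodesic the jump is trivial, because the path starts or stops there.\<close>
  have exit: "\<exists>t\<in>{0..b}. d (g v) (\<alpha> t) \<le> D \<and> D - 1 \<le> gromov_product d (g u) (g v) (\<alpha> t)"
    if v: "v \<in> {0..l}" and v': "\<bar>u - v\<bar> = 2 * D \<or> v = 0 \<or> v = l" for v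
  proof (cases "v = 0 \<or> v = l")
    case True
    then obtain t where t: "t \<in> {0..b}" "g v = \<alpha> t"
      using g0 gl b by (metis atLeastAtMost_iff order.refl)
    then have "gromov_product d (g u) (g v) (\<alpha> t) = d (g u) (\<alpha> t)"
      using alpha by (simp add: gromov_product_def)
    then show ?thesis using t far[of t] D0 alpha by (intro bexI[of _ t]) auto
  next
    case False
    with v' have "\<bar>u - v\<bar> = 2 * D" by simp
    moreover obtain t where t: "t \<in> {0..b}" "d (g v) (\<alpha> t) \<le> D"
      using near[of v] v by (auto simp: l_def)
    moreover have "d (g u) (g v) - d (g v) (\<alpha> t) \<le> gromov_product d (g u) (g v) (\<alpha> t)"
      using gromov_product_ge ul v t alpha gM by simp
    ultimately show ?thesis
      using gd[OF ul v] by (intro bexI[of _ t]) auto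
  qed
  define v where "v = max 0 (u - 2 * D)"
  define w where "w = min l (u + 2 * D)"
  have v: "v \<in> {0..l}" "\<bar>u - v\<bar> = 2 * D \<or> v = 0 \<or> v = l" "v \<le> u" "u - v \<le> 2 * D"
    and w: "w \<in> {0..l}" "\<bar>u - w\<bar> = 2 * D \<or> w = 0 \<or> w = l" "u \<le> w" "w - u \<le> 2 * D"
    using ul D0 by (auto simp: v_def w_def)
  obtain s where s: "s \<in> {0..b}" "d (g v) (\<alpha> s) \<le> D" "D - 1 \<le> gromov_product d (g u) (g v) (\<alpha> s)"
    using exit v by blast
  obtain t where t: "t \<in> {0..b}" "d (g w) (\<alpha> t) \<le> D" "D - 1 \<le> gromov_product d (g u) (g w) (\<alpha> t)"
    using exit w by blast
  have "\<bar>s - t\<bar> \<le> d (\<alpha> s) (\<alpha> t)" using lower s t by simp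
  also have "\<dots> \<le> d (\<alpha> s) (g v) + d (g v) (\<alpha> t)"
    using triangle alpha s t gM v by simp
  also have "d (g v) (\<alpha> t) \<le> d (g v) (g w) + d (g w) (\<alpha> t)"
    using triangle alpha s t gM v w by simp
  also have "d (g v) (g w) \<le> 4 * D" using gd v w by auto
  finally have st: "\<bar>s - t\<bar> \<le> 2 ^ k" using s(2) t(2) k by (simp add: commute)
  define c where "c i = s + (real i / 2 ^ k) * (t - s)" for i :: nat
  have c: "c i \<in> {0..b}" if "i \<le> 2 ^ k" for i
  proof -
    have "real i / 2 ^ k \<le> 1"
      using that by (simp add: field_simps)
    then have "(1 - real i / 2 ^ k) * s + (real i / 2 ^ k) * t \<in> {0..b}"
      using s(1) t(1) convexD_alt[of "{0..b}" s t "real i / 2 ^ k"] by simp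
    moreover have "(1 - real i / 2 ^ k) * s + (real i / 2 ^ k) * t = c i"
      unfolding c_def left_diff_distrib right_diff_distrib by simp
    ultimately show ?thesis by simp
  qed
  have "D - 1 - L \<le> gromov_product d (g u) (\<alpha> (c i)) (\<alpha> (c (Suc i)))" if i: "i < 2 ^ k" for i
  proof -
    have ci: "c i \<in> {0..b}" "c (Suc i) \<in> {0..b}" using c i by auto
    have "c i - c (Suc i) = (s - t) / 2 ^ k"
      by (simp add: c_def field_simps)
    then have "\<bar>c i - c (Suc i)\<bar> = \<bar>s - t\<bar> / 2 ^ k"
      by simp
    also have "\<dots> \<le> 1" using st by simp
    finally have "d (\<alpha> (c i)) (\<alpha> (c (Suc i))) \<le> L"
      using upper[of "c i" "c (Suc i)"] ci L by (smt (verit) atLeastAtMost_iff mult_left_le)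
    then show ?thesis
      using far[OF ci(1)] gromov_product_ge[of "g u" "\<alpha> (c i)" "\<alpha> (c (Suc i))"] ci alpha gM ul by simp
  qed
  then have "D - 1 - L - real k * \<delta> \<le> gromov_product d (g u) (\<alpha> (c 0)) (\<alpha> (c (2 ^ k)))"
    using c alpha gM ul by (intro gromov_product_chain[where y = "\<lambda>i. \<alpha> (c i)"]) auto
  then have mid: "D - 1 - L - real k * \<delta> \<le> gromov_product d (g u) (\<alpha> s) (\<alpha> t)"
    by (simp add: c_def)
  have kd: "0 \<le> real k * \<delta>" using delta_nonneg by simp
  have "min (gromov_product d (g u) (g v) (\<alpha> s)) (gromov_product d (g u) (\<alpha> s) (\<alpha> t)) - \<delta>
      \<le> gromov_product d (g u) (g v) (\<alpha> t)"
    using four_point gM ul v alpha s t by simp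
  then have "D - 1 - L - real k * \<delta> - \<delta> \<le> gromov_product d (g u) (g v) (\<alpha> t)"
    using mid s(3) L kd by linarith
  moreover have "min (gromov_product d (g u) (g v) (\<alpha> t)) (gromov_product d (g u) (\<alpha> t) (g w)) - \<delta>
      \<le> gromov_product d (g u) (g v) (g w)"
    using four_point gM ul v w alpha s t by simp
  ultimately have "D - 1 - L - real k * \<delta> - 2 * \<delta> \<le> gromov_product d (g u) (g v) (g w)"
    using t(3) L kd delta_nonneg gromov_product_commute[of "g u" "g w" "\<alpha> t"] by linarith
  moreover have "gromov_product d (g u) (g v) (g w) = 0"
    using gd v w ul by (simp add: gromov_product_def)
  ultimately show False using D by (simp add: algebra_simps)
qed

text \<open>The defect \<open>k * \<delta>\<close> grows like \<open>log D\<close>, hence more slowly than \<open>D\<close>.\<close>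

lemma improvement_threshold:
  "\<exists>K\<ge>0. \<forall>D\<ge>K. \<exists>k. 6 * D \<le> 2 ^ k \<and> 1 + L + (real k + 2) * \<delta> < D"
proof -
  have "filterlim (\<lambda>D. D - (1 + L + (log 2 (6 * D) + 3) * \<delta>)) at_top at_top"
    using delta_nonneg by real_asymp
  then have "eventually (\<lambda>D. 0 < D - (1 + L + (log 2 (6 * D) + 3) * \<delta>) \<and> 1 \<le> D) at_top"
    using filterlim_at_top_dense[THEN iffD1, rule_format, of _ at_top 0]
    by (intro eventually_conj eventually_ge_at_top) blast
  then obtain K where K: "\<And>D. D \<ge> K \<Longrightarrow> 0 < D - (1 + L + (log 2 (6 * D) + 3) * \<delta>) \<and> 1 \<le> D"
    by (auto simp: eventually_at_top_linorder)
  have "\<exists>k. 6 * D \<le> 2 ^ k \<and> 1 + L + (real k + 2) * \<delta> < D" if "D \<ge> max 0 K" for D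
  proof -
    have D: "0 < D - (1 + L + (log 2 (6 * D) + 3) * \<delta>)" "1 \<le> D" using K that by auto
    define k where "k = nat \<lceil>log 2 (6 * D)\<rceil>"
    have l0: "0 \<le> log 2 (6 * D)" using D by simp
    then have k: "log 2 (6 * D) \<le> real k" "real k \<le> log 2 (6 * D) + 1"
      unfolding k_def by linarith+
    have "6 * D \<le> 2 ^ k"
      using k(1) D by (simp add: log_le_iff powr_realpow)
    moreover have "(real k + 2) * \<delta> \<le> (log 2 (6 * D) + 3) * \<delta>"
      using k(2) delta_nonneg by (intro mult_right_mono) auto
    ultimately show ?thesis using D by (intro exI[of _ k]) auto
  qed
  then show ?thesis by (intro exI[of _ "max 0 K"]) auto
qed

text \<open>The trivial bound \<open>d (\<alpha> 0) (\<alpha> b)\<close> on the distance to the path can be lowered by \<open>1\<close> as long as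
  it exceeds the threshold, which depends on \<open>L\<close> and \<open>\<delta>\<close> only. Of the Morse lemma this is the half in
  which the geodesic is near the path; the other half follows for rays from
  \<open>quasigeodesic_near_shadowed_ray\<close> below.\<close>

lemma geodesic_near_quasigeodesic:
  assumes "0 \<le> L"
  obtains K where "\<And>\<alpha> b g u. \<lbrakk>\<And>t. 0 \<le> t \<Longrightarrow> \<alpha> t \<in> M;
      \<And>s t. \<lbrakk>0 \<le> s; 0 \<le> t\<rbrakk> \<Longrightarrow> d (\<alpha> s) (\<alpha> t) \<le> L * \<bar>s - t\<bar>;
      \<And>s t. \<lbrakk>0 \<le> s; 0 \<le> t\<rbrakk> \<Longrightarrow> \<bar>s - t\<bar> \<le> d (\<alpha> s) (\<alpha> t);
      0 \<le> b; geodesic_segment M d (\<alpha> 0) (\<alpha> b) g; u \<in> {0..d (\<alpha> 0) (\<alpha> b)}\<rbrakk> \<Longrightarrow>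
      \<exists>t\<in>{0..b}. d (g u) (\<alpha> t) \<le> K"
proof -
  obtain K where K: "0 \<le> K" "\<And>D. D \<ge> K \<Longrightarrow> \<exists>k. 6 * D \<le> 2 ^ k \<and> 1 + L + (real k + 2) * \<delta> < D"
    using improvement_threshold by blast
  show thesis
  proof (rule that[of K])
    fix \<alpha> b g u
    assume \<alpha>: "\<And>t. 0 \<le> t \<Longrightarrow> \<alpha> t \<in> M"
      "\<And>s t. \<lbrakk>0 \<le> s; 0 \<le> t\<rbrakk> \<Longrightarrow> d (\<alpha> s) (\<alpha> t) \<le> L * \<bar>s - t\<bar>"
      "\<And>s t. \<lbrakk>0 \<le> s; 0 \<le> t\<rbrakk> \<Longrightarrow> \<bar>s - t\<bar> \<le> d (\<alpha> s) (\<alpha> t)"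
      and b: "0 \<le> b" and g: "geodesic_segment M d (\<alpha> 0) (\<alpha> b) g"
      and u: "u \<in> {0..d (\<alpha> 0) (\<alpha> b)}"
    define P where "P D \<longleftrightarrow> (\<forall>v\<in>{0..d (\<alpha> 0) (\<alpha> b)}. \<exists>t\<in>{0..b}. d (g v) (\<alpha> t) \<le> D)" for D
    have step: "P D" if PD: "P (D + 1)" and KD: "K \<le> D" for D
    proof -
      obtain k where k: "6 * (D + 1) \<le> 2 ^ k" "1 + L + (real k + 2) * \<delta> < D + 1"
        using K(2)[of "D + 1"] KD by auto
      have "\<exists>t\<in>{0..b}. d (g v) (\<alpha> t) \<le> D + 1 - 1" if "v \<in> {0..d (\<alpha> 0) (\<alpha> b)}" for v
        by (rule geodesic_near_path_improve[OF \<alpha> b g assms k _ that])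
          (use PD in \<open>auto simp: P_def\<close>)
      then show ?thesis by (simp add: P_def)
    qed
    have down: "P (K + real n) \<Longrightarrow> P K" for n
    proof (induction n)
      case (Suc n)
      then show ?case using step[of "K + real n"] by (simp add: algebra_simps)
    qed simp
    obtain n where n: "d (\<alpha> 0) (\<alpha> b) \<le> real n" using real_arch_simple by blast
    have "P (K + real n)"
      unfolding P_def
    proof (intro ballI bexI[of _ 0])
      fix v assume v: "v \<in> {0..d (\<alpha> 0) (\<alpha> b)}"
      have zero_in: "0 \<in> {0..d (\<alpha> 0) (\<alpha> b)}" by simp
      have "d (g v) (g 0) = \<bar>v - 0\<bar>" "g 0 = \<alpha> 0"
        using g v zero_in unfolding geodesic_segment_def by blast+
      then show "d (g v) (\<alpha> 0) \<le> K + real n" using v n K(1) by auto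
    qed (use b in auto)
    then show "\<exists>t\<in>{0..b}. d (g u) (\<alpha> t) \<le> K"
      using down u by (auto simp: P_def)
  qed
qed

end

section \<open>Limits of geodesic segments in proper spaces\<close>

text \<open>Properness is stated through sequences, which is how it is both proved and used below.\<close>

locale proper_metric_space = Metric_space +
  assumes bounded_subconverges: "\<lbrakk>p \<in> M; range x \<subseteq> M; \<And>n::nat. d p (x n) \<le> R\<rbrakk> \<Longrightarrow>
      \<exists>l\<in>M. \<exists>r. strict_mono r \<and> (\<lambda>n. d (x (r n)) l) \<longlonglongrightarrow> 0"
begin

lemma geodesic_segment_prolonged:
  assumes g: "geodesic_segment M d p x g" and t: "0 \<le> t"
  shows "g t = g (min t (d p x))" "g t \<in> M"
proof -
  show *: "g t = g (min t (d p x))"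
    using g by (auto simp: geodesic_segment_def min_def)
  have "min t (d p x) \<in> {0..d p x}" using t by auto
  then show "g t \<in> M"
    using g unfolding * geodesic_segment_def by blast
qed

lemma geodesic_segment_dist:
  assumes g: "geodesic_segment M d p x g" and "0 \<le> s" "0 \<le> t"
  shows "d (g s) (g t) = \<bar>min s (d p x) - min t (d p x)\<bar>"
proof -
  have "min s (d p x) \<in> {0..d p x}" "min t (d p x) \<in> {0..d p x}" using assms by auto
  then have "d (g (min s (d p x))) (g (min t (d p x))) = \<bar>min s (d p x) - min t (d p x)\<bar>"
    using g unfolding geodesic_segment_def by blast
  then show ?thesis using geodesic_segment_prolonged(1)[OF g] assms by metis
qed

text \<open>The points of the segments at a fixed time \<open>q\<close> stay in a ball of radius \<open>q\<close> around \<open>p\<close>; a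
  diagonal subsequence converges at all rational times.\<close>

lemma geodesic_segments_Cauchy_subsequence:
  assumes p: "p \<in> M" and g: "\<And>n. geodesic_segment M d p (x n) (g n)"
  obtains r :: "nat \<Rightarrow> nat" where "strict_mono r"
    "\<And>q. \<lbrakk>q \<in> \<rat>; 0 \<le> q\<rbrakk> \<Longrightarrow> \<exists>l\<in>M. (\<lambda>n. d (g (r n) q) l) \<longlonglongrightarrow> 0"
proof -
  \<comment> \<open>Absolute values turn an enumeration of the rationals into one of the nonnegative rationals.\<close>
  define e :: "nat \<Rightarrow> real" where "e k = \<bar>from_nat_into \<rat> k\<bar>" for k
  define P where "P k r \<longleftrightarrow> (\<exists>l\<in>M. (\<lambda>n. d (g (r n) (e k)) l) \<longlonglongrightarrow> 0)" for k and r :: "nat \<Rightarrow> nat"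
  have e0: "0 \<le> e k" for k by (simp add: e_def)
  interpret subseqs P
  proof
    fix k and s :: "nat \<Rightarrow> nat" assume "strict_mono s"
    have "d p (g (s n) (e k)) \<le> e k" for n
    proof -
      have "g (s n) 0 = p" using g by (auto simp: geodesic_segment_def)
      then show ?thesis
        using geodesic_segment_dist[OF g order.refl e0, of "s n" k] e0[of k] by auto
    qed
    moreover have "range (\<lambda>n. g (s n) (e k)) \<subseteq> M"
      using geodesic_segment_prolonged(2)[OF g e0] by auto
    ultimately show "\<exists>r'. strict_mono r' \<and> P k (s \<circ> r')"
      using bounded_subconverges[OF p, of "\<lambda>n. g (s n) (e k)" "e k"]
      unfolding P_def o_def by blast
  qed
  have stable: "P k (s \<circ> r)" if "strict_mono r" "P k s" for r s k
    using that(2) LIMSEQ_subseq_LIMSEQ[OF _ that(1)] unfolding P_def by (fastforce simp: o_def)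
  show thesis
  proof (rule that[OF subseq_diagseq])
    fix q :: real assume q: "q \<in> \<rat>" "0 \<le> q"
    obtain k where "from_nat_into \<rat> k = q"
      using from_nat_into_surj[OF countable_rat q(1)] by blast
    then have k: "q = e k" using q(2) by (simp add: e_def)
    have "P k (diagseq \<circ> ((+) (Suc k)))" by (rule diagseq_holds) (rule stable)
    then obtain l where l: "l \<in> M" "(\<lambda>n. d (g (diagseq (Suc k + n)) q) l) \<longlonglongrightarrow> 0"
      by (auto simp: P_def k)
    then have "(\<lambda>n. d (g (diagseq n) q) l) \<longlonglongrightarrow> 0"
      using LIMSEQ_offset[of "\<lambda>n. d (g (diagseq n) q) l" "Suc k"] by (simp add: add.commute)
    with l(1) show "\<exists>l\<in>M. (\<lambda>n. d (g (diagseq n) q) l) \<longlonglongrightarrow> 0" by blast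
  qed
qed

text \<open>Prolonged segments are \<open>1\<close>-Lipschitz, so that convergence at the finitely many times \<open>i / J\<close> in
  \<open>{0..R}\<close> controls all of \<open>{0..R}\<close> up to an error \<open>2 / J\<close>.\<close>

lemma geodesic_segments_uniformly_Cauchy:
  assumes g: "\<And>n. geodesic_segment M d p (x n) (g n)"
    and conv: "\<And>q. \<lbrakk>q \<in> \<rat>; 0 \<le> q\<rbrakk> \<Longrightarrow> \<exists>l\<in>M. (\<lambda>n. d (g n q) l) \<longlonglongrightarrow> 0"
    and eps: "0 < \<epsilon>"
  shows "\<exists>N. \<forall>m\<ge>N. \<forall>n\<ge>N. \<forall>t\<in>{0..R}. d (g m t) (g n t) < \<epsilon>"
proof -
  obtain J :: nat where J: "6 / \<epsilon> < real J" using reals_Archimedean2 by blast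
  then have J0: "0 < real J" using eps by (smt (verit) divide_pos_pos)
  obtain I :: nat where I: "R * real J \<le> real I" using real_arch_simple by blast
  have "\<forall>\<^sub>F N in sequentially. \<forall>i\<in>{..I}. \<forall>m\<ge>N. \<forall>n\<ge>N. d (g m (real i / J)) (g n (real i / J)) < \<epsilon> / 3"
  proof (intro eventually_ball_finite ballI)
    fix i
    obtain l where l: "l \<in> M" "(\<lambda>n. d (g n (real i / J)) l) \<longlonglongrightarrow> 0"
      using conv[of "real i / J"] by auto
    then have "\<forall>\<^sub>F n in sequentially. d (g n (real i / J)) l < \<epsilon> / 6"
      using eps by (intro order_tendstoD(2)[OF l(2)]) simp
    then obtain N where N: "\<And>n. n \<ge> N \<Longrightarrow> d (g n (real i / J)) l < \<epsilon> / 6"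
      by (auto simp: eventually_sequentially)
    have "d (g m (real i / J)) (g n (real i / J)) < \<epsilon> / 3" if "m \<ge> N" "n \<ge> N" for m n
      using N[OF that(1)] N[OF that(2)] triangle'[of "g m (real i / J)" l "g n (real i / J)"]
        geodesic_segment_prolonged(2)[OF g] l(1) by (simp add: commute)
    then show "\<forall>\<^sub>F N in sequentially. \<forall>m\<ge>N. \<forall>n\<ge>N. d (g m (real i / J)) (g n (real i / J)) < \<epsilon> / 3"
      by (auto simp: eventually_sequentially intro!: exI[of _ N])
  qed simp
  from eventually_happens'[OF sequentially_bot this]
  obtain N where N: "\<And>i m n. \<lbrakk>i \<le> I; m \<ge> N; n \<ge> N\<rbrakk> \<Longrightarrow>
      d (g m (real i / J)) (g n (real i / J)) < \<epsilon> / 3"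
    by blast
  have "d (g m t) (g n t) < \<epsilon>" if mn: "m \<ge> N" "n \<ge> N" and t: "t \<in> {0..R}" for m n t
  proof -
    define i where "i = nat \<lfloor>t * J\<rfloor>"
    have "0 \<le> t * J" using t by simp
    then have "real i = real_of_int \<lfloor>t * J\<rfloor>" by (simp add: i_def)
    then have i: "real i \<le> t * J" "t * J < real i + 1" by linarith+
    have "t * real J \<le> R * real J" using t J0 by (intro mult_right_mono) auto
    then have "i \<le> I" using i(1) I by linarith
    have ti: "\<bar>t - real i / J\<bar> < \<epsilon> / 3"
    proof -
      have "t - real i / J = (t * J - real i) / J" using J0 by (simp add: field_simps)
      also have "\<bar>\<dots>\<bar> \<le> 1 / J" using i J0 by (simp add: divide_right_mono)
      also have "\<dots> < \<epsilon> / 6" using J J0 eps by (simp add: field_simps)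
      finally show ?thesis using eps by simp
    qed
    have close: "d (g k t) (g k (real i / J)) < \<epsilon> / 3" for k
    proof -
      have "d (g k t) (g k (real i / J)) = \<bar>min t (d p (x k)) - min (real i / J) (d p (x k))\<bar>"
        using geodesic_segment_dist[OF g, of t "real i / J" k] t by simp
      also have "\<dots> \<le> \<bar>t - real i / J\<bar>" by linarith
      finally show ?thesis using ti by simp
    qed
    have M: "g k t \<in> M" "g k (real i / J) \<in> M" for k
      using geodesic_segment_prolonged(2)[OF g] t by auto
    show ?thesis
      using close[of m] close[of n] N[OF \<open>i \<le> I\<close> mn]
        triangle[OF M(1)[of m] M(2)[of m] M(1)[of n]]
        triangle'[OF M(2)[of m] M(2)[of n] M(1)[of n]] by linarith
  qed
  then show ?thesis by blast
qed

text \<open>The theorem of Arzela and Ascoli for the prolonged segments. The limit is a ray, not merely a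
  \<open>1\<close>-Lipschitz curve, because the lengths tend to infinity.\<close>

lemma geodesic_segments_subconverge_to_ray:
  assumes p: "p \<in> M" and g: "\<And>n. geodesic_segment M d p (x n) (g n)"
    and far: "filterlim (\<lambda>n. d p (x n)) at_top sequentially"
  obtains r \<rho> where "strict_mono (r :: nat \<Rightarrow> nat)" "geodesic_ray M d \<rho>"
    "locally_uniform_limit d (g \<circ> r) \<rho>"
proof -
  obtain r :: "nat \<Rightarrow> nat" where r: "strict_mono r"
    and conv: "\<And>q. \<lbrakk>q \<in> \<rat>; 0 \<le> q\<rbrakk> \<Longrightarrow> \<exists>l\<in>M. (\<lambda>n. d (g (r n) q) l) \<longlonglongrightarrow> 0"
    by (rule geodesic_segments_Cauchy_subsequence[where x = x and g = g, OF p g]) blast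
  have Cauchy: "\<exists>N. \<forall>m\<ge>N. \<forall>n\<ge>N. \<forall>t\<in>{0..R}. d (g (r m) t) (g (r n) t) < \<epsilon>" if "0 < \<epsilon>" for \<epsilon> R :: real
    by (rule geodesic_segments_uniformly_Cauchy[where x = "\<lambda>n. x (r n)" and g = "\<lambda>n. g (r n)"])
      (rule g conv that; assumption)+
  have gM: "g n t \<in> M" if "0 \<le> t" for n t
    using geodesic_segment_prolonged(2)[OF g that] .
  have "\<exists>l\<in>M. \<exists>s. strict_mono s \<and> (\<lambda>n. d (g (r (s n)) t) l) \<longlonglongrightarrow> 0" if t: "0 \<le> t" for t
  proof (rule bounded_subconverges[OF p])
    show "range (\<lambda>n. g (r n) t) \<subseteq> M" using gM t by auto
    show "d p (g (r n) t) \<le> t" for n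
    proof -
      have "g (r n) 0 = p" using g by (auto simp: geodesic_segment_def)
      then show ?thesis
        using geodesic_segment_dist[OF g order.refl t, of "r n"] t by auto
    qed
  qed
  then have "\<forall>t\<in>{0..}. \<exists>l. l \<in> M \<and> (\<exists>s. strict_mono s \<and> (\<lambda>n. d (g (r (s n)) t) l) \<longlonglongrightarrow> 0)"
    by (simp add: Bex_def)
  from bchoice[OF this] obtain \<rho> where \<rho>: "\<And>t. 0 \<le> t \<Longrightarrow> \<rho> t \<in> M"
    and lim: "\<And>t. 0 \<le> t \<Longrightarrow> \<exists>s. strict_mono s \<and> (\<lambda>n. d (g (r (s n)) t) (\<rho> t)) \<longlonglongrightarrow> 0"
    by auto
  have lul: "locally_uniform_limit d (g \<circ> r) \<rho>"
    unfolding locally_uniform_limit_def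
  proof (intro allI impI)
    fix R \<epsilon> :: real assume eps: "0 < \<epsilon>"
    have "0 < \<epsilon> / 2" using eps by simp
    from Cauchy[OF this, of R]
    obtain N where N: "\<And>m n t. \<lbrakk>m \<ge> N; n \<ge> N; t \<in> {0..R}\<rbrakk> \<Longrightarrow> d (g (r m) t) (g (r n) t) < \<epsilon> / 2"
      by blast
    have "d (g (r m) t) (\<rho> t) < \<epsilon>" if m: "m \<ge> N" and t: "t \<in> {0..R}" for m t
    proof -
      have t0: "0 \<le> t" using t by simp
      obtain s where s: "strict_mono s" "(\<lambda>n. d (g (r (s n)) t) (\<rho> t)) \<longlonglongrightarrow> 0"
        using lim[OF t0] by blast
      have "\<forall>\<^sub>F n in sequentially. d (g (r (s n)) t) (\<rho> t) < \<epsilon> / 2 \<and> N \<le> n"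
        using eps by (intro eventually_conj order_tendstoD(2)[OF s(2)] eventually_ge_at_top) simp
      from eventually_happens'[OF sequentially_bot this]
      obtain n where n: "d (g (r (s n)) t) (\<rho> t) < \<epsilon> / 2" "N \<le> n"
        by blast
      have "N \<le> s n" using n(2) seq_suble[OF s(1), of n] by linarith
      then show ?thesis
        using n(1) N[OF m _ t, of "s n"] triangle[OF gM gM \<rho>, OF t0 t0 t0, of "r m" "r (s n)"]
        by linarith
    qed
    then show "\<forall>\<^sub>F n in sequentially. \<forall>t\<in>{0..R}. d ((g \<circ> r) n t) (\<rho> t) < \<epsilon>"
      by (auto simp: eventually_sequentially intro!: exI[of _ N])
  qed
  have "d (\<rho> a) (\<rho> b) = \<bar>a - b\<bar>" if ab: "0 \<le> a" "0 \<le> b" for a b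
  proof -
    have "\<bar>d (\<rho> a) (\<rho> b) - \<bar>a - b\<bar>\<bar> < \<epsilon>" if eps: "0 < \<epsilon>" for \<epsilon> :: real
    proof -
      have "\<forall>\<^sub>F n in sequentially. \<forall>t\<in>{0..max a b}. d ((g \<circ> r) n t) (\<rho> t) < \<epsilon> / 2"
        using lul eps unfolding locally_uniform_limit_def by (meson half_gt_zero)
      moreover have "filterlim (\<lambda>n. d p (x (r n))) at_top sequentially"
        using filterlim_compose[OF far filterlim_subseq[OF r]] .
      then have "\<forall>\<^sub>F n in sequentially. max a b \<le> d p (x (r n))"
        unfolding filterlim_at_top by blast
      ultimately have "\<forall>\<^sub>F n in sequentially. (\<forall>t\<in>{0..max a b}. d ((g \<circ> r) n t) (\<rho> t) < \<epsilon> / 2)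
          \<and> max a b \<le> d p (x (r n))"
        by (rule eventually_conj)
      from eventually_happens'[OF sequentially_bot this]
      obtain n where n: "\<And>t. t \<in> {0..max a b} \<Longrightarrow> d (g (r n) t) (\<rho> t) < \<epsilon> / 2"
          "max a b \<le> d p (x (r n))"
        unfolding o_def by blast
      have "d (g (r n) a) (g (r n) b) = \<bar>a - b\<bar>"
        using geodesic_segment_dist[OF g ab, of "r n"] n(2) by auto
      moreover have "d (g (r n) a) (\<rho> a) < \<epsilon> / 2" "d (g (r n) b) (\<rho> b) < \<epsilon> / 2"
        using n(1) ab by auto
      ultimately show ?thesis
        using triangle''[OF \<rho>[OF ab(1)] gM[OF ab(1), of "r n"] \<rho>[OF ab(2)]]
          triangle[OF gM[OF ab(1), of "r n"] gM[OF ab(2), of "r n"] \<rho>[OF ab(2)]]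
          triangle[OF gM[OF ab(1), of "r n"] \<rho>[OF ab(1)] gM[OF ab(2), of "r n"]]
          triangle'[OF \<rho>[OF ab(1)] \<rho>[OF ab(2)] gM[OF ab(2), of "r n"]] by linarith
    qed
    from this[of "\<bar>d (\<rho> a) (\<rho> b) - \<bar>a - b\<bar>\<bar>"] show ?thesis by fastforce
  qed
  then have "geodesic_ray M d \<rho>" using \<rho> by (auto simp: geodesic_ray_def)
  with r lul show thesis using that by blast
qed

end

section \<open>Boundary points as limits of sequences\<close>

locale proper_gromov_hyperbolic_space = proper_metric_space + gromov_hyperbolic_space
begin

text \<open>Before the time \<open>d p x\<close> the points \<open>g t\<close> and \<open>h t\<close> both have Gromov product \<open>t\<close> with \<open>x\<close>,
  hence a Gromov product of at least \<open>t - \<delta>\<close> with each other.\<close>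

lemma geodesic_segments_fellow_travel:
  assumes p: "p \<in> M" and x: "x \<in> M" and t: "0 \<le> t"
    and g: "geodesic_segment M d p x g" and h: "geodesic_segment M d p x h"
  shows "d (g t) (h t) \<le> 2 * \<delta>"
proof -
  define \<tau> where "\<tau> = min t (d p x)"
  have \<tau>: "0 \<le> \<tau>" "\<tau> \<le> d p x" using t by (auto simp: \<tau>_def)
  have prod: "gromov_product d p (k \<tau>) x = \<tau>" "k \<tau> \<in> M" "k t = k \<tau>" "d p (k \<tau>) = \<tau>"
    if k: "geodesic_segment M d p x k" for k
  proof -
    have "k 0 = p" "k (d p x) = x" using k by (auto simp: geodesic_segment_def)
    then show "d p (k \<tau>) = \<tau>" "gromov_product d p (k \<tau>) x = \<tau>"
      using geodesic_segment_dist[OF k order.refl, of \<tau>] \<tau>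
        geodesic_segment_dist[OF k, of \<tau> "d p x"] by (auto simp: gromov_product_def)
    show "k \<tau> \<in> M" using geodesic_segment_prolonged(2)[OF k] \<tau> by simp
    show "k t = k \<tau>" using geodesic_segment_prolonged(1)[OF k t] by (simp add: \<tau>_def)
  qed
  have "min (gromov_product d p (g \<tau>) x) (gromov_product d p x (h \<tau>)) - \<delta>
      \<le> gromov_product d p (g \<tau>) (h \<tau>)"
    using four_point p x prod(2)[OF g] prod(2)[OF h] by simp
  then have "\<tau> - \<delta> \<le> gromov_product d p (g \<tau>) (h \<tau>)"
    using prod(1)[OF g] prod(1)[OF h] gromov_product_commute[of p x "h \<tau>"] by simp
  also have "\<dots> = \<tau> - d (g \<tau>) (h \<tau>) / 2"
    using prod(4)[OF g] prod(4)[OF h] by (simp add: gromov_product_def)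
  finally show ?thesis using prod(3)[OF g] prod(3)[OF h] by simp
qed

text \<open>Convergence to a boundary point speaks of all choices of segments from \<open>p\<close> to the points. A limit
  for one choice suffices, because other segments fellow-travel and have asymptotic limits.\<close>

lemma points_subconverge_to_boundary:
  assumes p: "p \<in> M" and x: "\<And>n. x n \<in> M"
    and g: "\<And>n. geodesic_segment M d p (x n) (g n)"
    and far: "filterlim (\<lambda>n. d p (x n)) at_top sequentially"
  obtains r \<rho> where "strict_mono (r :: nat \<Rightarrow> nat)" "geodesic_ray M d \<rho>"
    "locally_uniform_limit d (g \<circ> r) \<rho>"
    "points_tendsto_boundary M d (x \<circ> r) (asymptotic_rays M d `` {\<rho>})"
proof -
  obtain r \<rho> where r: "strict_mono (r :: nat \<Rightarrow> nat)" and \<rho>: "geodesic_ray M d \<rho>"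
    and lim: "locally_uniform_limit d (g \<circ> r) \<rho>"
    by (rule geodesic_segments_subconverge_to_ray[where x = x and g = g, OF p g far])
  have "subconverges_to d h (asymptotic_rays M d `` {\<rho>})"
    if h: "\<forall>n. geodesic_segment M d p ((x \<circ> r) n) (h n)" for h
    unfolding subconverges_to_def
  proof (intro allI impI)
    fix q :: "nat \<Rightarrow> nat" assume q: "strict_mono q"
    have far': "filterlim (\<lambda>n. d p (x (r (q n)))) at_top sequentially"
      using filterlim_compose[OF far filterlim_subseq[OF strict_mono_o[OF r q]]] by (simp add: o_def)
    have h': "geodesic_segment M d p (x (r (q n))) (h (q n))" for n using h by simp
    obtain s \<sigma> where s: "strict_mono (s :: nat \<Rightarrow> nat)" and \<sigma>: "geodesic_ray M d \<sigma>"
      and lim': "locally_uniform_limit d ((\<lambda>n. h (q n)) \<circ> s) \<sigma>"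
      by (rule geodesic_segments_subconverge_to_ray
          [where x = "\<lambda>n. x (r (q n))" and g = "\<lambda>n. h (q n)", OF p h' far'])
    have "d (\<rho> t) (\<sigma> t) \<le> 2 * \<delta> + 2" if t: "0 \<le> t" for t
    proof -
      have "\<forall>\<^sub>F n in sequentially. \<forall>v\<in>{0..t}. d ((g \<circ> r) n v) (\<rho> v) < 1"
        using lim unfolding locally_uniform_limit_def by (meson zero_less_one)
      then have "\<forall>\<^sub>F n in sequentially. \<forall>v\<in>{0..t}. d ((g \<circ> r) (q (s n)) v) (\<rho> v) < 1"
        using eventually_subseq[OF strict_mono_o[OF q s]] by simp
      moreover have "\<forall>\<^sub>F n in sequentially. \<forall>v\<in>{0..t}. d (((\<lambda>n. h (q n)) \<circ> s) n v) (\<sigma> v) < 1"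
        using lim' unfolding locally_uniform_limit_def by (meson zero_less_one)
      ultimately have "\<forall>\<^sub>F n in sequentially. d (g (r (q (s n))) t) (\<rho> t) < 1 \<and> d (h (q (s n)) t) (\<sigma> t) < 1"
        by eventually_elim (use t in auto)
      from eventually_happens'[OF sequentially_bot this]
      obtain n where n: "d (g (r (q (s n))) t) (\<rho> t) < 1" "d (h (q (s n)) t) (\<sigma> t) < 1" by blast
      have "d (g (r (q (s n))) t) (h (q (s n)) t) \<le> 2 * \<delta>"
        by (rule geodesic_segments_fellow_travel[OF p x t g h'])
      moreover have M: "g (r (q (s n))) t \<in> M" "h (q (s n)) t \<in> M" "\<rho> t \<in> M" "\<sigma> t \<in> M"
        using geodesic_segment_prolonged(2)[OF g t] geodesic_segment_prolonged(2)[OF h' t]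
          \<rho> \<sigma> t by (auto simp: geodesic_ray_def)
      ultimately show ?thesis
        using n triangle''[OF M(3) M(1) M(4)] triangle[OF M(1) M(2) M(4)] by linarith
    qed
    then have "bdd_above ((\<lambda>t. d (\<rho> t) (\<sigma> t)) ` {0..})"
      by (intro bdd_aboveI2[where M = "2 * \<delta> + 2"]) simp
    then have "\<sigma> \<in> asymptotic_rays M d `` {\<rho>}"
      using \<rho> \<sigma> by (simp add: asymptotic_rays_def)
    with s lim' show "\<exists>s. strict_mono s \<and>
        (\<exists>\<sigma>\<in>asymptotic_rays M d `` {\<rho>}. locally_uniform_limit d (h \<circ> q \<circ> s) \<sigma>)"
      by (auto simp: o_def)
  qed
  then have "points_tendsto_boundary M d (x \<circ> r) (asymptotic_rays M d `` {\<rho>})"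
    using p unfolding points_tendsto_boundary_def by blast
  with r \<rho> lim show thesis using that by blast
qed

end

text \<open>Choose for each \<open>n\<close> a time \<open>\<tau> n\<close> such that \<open>\<alpha> (\<tau> n)\<close> is \<open>K\<close>-close to \<open>\<rho> n\<close>. Consecutive
  times differ by at most \<open>2 * K + 1\<close>, and they are unbounded because \<open>\<rho>\<close> is; hence every time is
  at bounded distance from some \<open>\<tau> n\<close>.\<close>

lemma (in Metric_space) quasigeodesic_near_shadowed_ray:
  assumes alpha: "\<And>t. 0 \<le> t \<Longrightarrow> \<alpha> t \<in> M"
    and upper: "\<And>s t. \<lbrakk>0 \<le> s; 0 \<le> t\<rbrakk> \<Longrightarrow> d (\<alpha> s) (\<alpha> t) \<le> L * \<bar>s - t\<bar>"
    and lower: "\<And>s t. \<lbrakk>0 \<le> s; 0 \<le> t\<rbrakk> \<Longrightarrow> \<bar>s - t\<bar> \<le> d (\<alpha> s) (\<alpha> t)"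
    and L: "0 \<le> L"
    and ray: "geodesic_ray M d \<rho>"
    and near: "\<And>u. 0 \<le> u \<Longrightarrow> \<exists>t\<ge>0. d (\<rho> u) (\<alpha> t) \<le> K"
  shows "\<exists>C. \<forall>t\<ge>0. \<exists>u\<ge>0. d (\<alpha> t) (\<rho> u) \<le> C"
proof -
  have rM: "\<rho> u \<in> M" if "0 \<le> u" for u using ray that by (auto simp: geodesic_ray_def)
  have rd: "d (\<rho> u) (\<rho> v) = \<bar>u - v\<bar>" if "0 \<le> u" "0 \<le> v" for u v
    using ray that by (auto simp: geodesic_ray_def)
  have "\<forall>n::nat. \<exists>t. 0 \<le> t \<and> d (\<rho> (real n)) (\<alpha> t) \<le> K" using near by simp
  from choice[OF this] obtain \<tau> where \<tau>: "\<And>n. 0 \<le> \<tau> n" "\<And>n. d (\<rho> (real n)) (\<alpha> (\<tau> n)) \<le> K"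
    by blast
  have unbounded: "\<exists>n. t \<le> \<tau> n" if "0 \<le> t" for t
  proof (rule ccontr)
    assume "\<nexists>n. t \<le> \<tau> n"
    then have small: "\<tau> n < t" for n by (simp add: not_le)
    obtain n :: nat where n: "d (\<rho> 0) (\<alpha> 0) + L * t + K < n" using reals_Archimedean2 by blast
    have "d (\<alpha> 0) (\<alpha> (\<tau> n)) \<le> L * \<tau> n" using upper[of 0 "\<tau> n"] \<tau>(1)[of n] by simp
    also have "\<dots> \<le> L * t" using small[of n] L by (simp add: mult_left_mono)
    finally have "d (\<alpha> 0) (\<alpha> (\<tau> n)) \<le> L * t" .
    moreover have "d (\<rho> 0) (\<rho> n) \<le> d (\<rho> 0) (\<alpha> 0) + d (\<alpha> 0) (\<rho> n)"
      "d (\<alpha> 0) (\<rho> n) \<le> d (\<alpha> 0) (\<alpha> (\<tau> n)) + d (\<rho> n) (\<alpha> (\<tau> n))"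
      using triangle triangle' rM alpha \<tau>(1) by simp_all
    ultimately show False using rd[of 0 n] \<tau>(2)[of n] n by simp
  qed
  define C where "C = L * (\<tau> 0 + \<bar>2 * K + 1\<bar>) + K"
  have "\<exists>u\<ge>0. d (\<alpha> t) (\<rho> u) \<le> C" if t: "0 \<le> t" for t
  proof -
    define n where "n = (LEAST n. t \<le> \<tau> n)"
    have n: "t \<le> \<tau> n" unfolding n_def using unbounded[OF t] by (rule LeastI_ex)
    have "\<bar>t - \<tau> n\<bar> \<le> \<tau> 0 + \<bar>2 * K + 1\<bar>"
    proof (cases n)
      case 0
      then show ?thesis using n t by simp
    next
      case (Suc m)
      then have m: "\<tau> m < t"
        using not_less_Least[of m "\<lambda>n. t \<le> \<tau> n"] by (simp add: n_def not_le)
      have "\<bar>\<tau> m - \<tau> n\<bar> \<le> d (\<alpha> (\<tau> m)) (\<alpha> (\<tau> n))" using lower \<tau>(1) by simp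
      also have "\<dots> \<le> d (\<rho> m) (\<alpha> (\<tau> m)) + d (\<rho> m) (\<alpha> (\<tau> n))"
        using triangle'' rM alpha \<tau>(1) by simp
      also have "d (\<rho> m) (\<alpha> (\<tau> n)) \<le> d (\<rho> m) (\<rho> n) + d (\<rho> n) (\<alpha> (\<tau> n))"
        using triangle rM alpha \<tau>(1) by simp
      also have "d (\<rho> m) (\<rho> n) = 1" using rd Suc by simp
      finally have "\<bar>\<tau> m - \<tau> n\<bar> \<le> 2 * K + 1" using \<tau>(2)[of m] \<tau>(2)[of n] by simp
      then show ?thesis using m n \<tau>(1)[of 0] by linarith
    qed
    then have "L * \<bar>t - \<tau> n\<bar> \<le> L * (\<tau> 0 + \<bar>2 * K + 1\<bar>)" using L by (rule mult_left_mono)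
    moreover have "d (\<alpha> t) (\<rho> n) \<le> d (\<alpha> t) (\<alpha> (\<tau> n)) + d (\<rho> n) (\<alpha> (\<tau> n))"
      using triangle' rM alpha \<tau>(1) t by simp
    ultimately have "d (\<alpha> t) (\<rho> n) \<le> C"
      using upper[OF t \<tau>(1), of n] \<tau>(2)[of n] by (simp add: C_def)
    then show ?thesis by (intro exI[of _ "real n"]) simp
  qed
  then show ?thesis by blast
qed


section \<open>Spaces whose Gromov compactification is their Euclidean closure\<close>

text \<open>The axiom \<open>dist_tendsto_0\<close> says that the Euclidean topology is at least as fine as that of \<open>d\<close>.
  The condition \<open>frontier_nonempty\<close> provides a point in the Gromov boundary.\<close>

locale gromov_model = Metric_space X d for X :: "'a::heine_borel set" and d +
  fixes \<Phi> :: "'a + (real \<Rightarrow> 'a) set \<Rightarrow> 'a"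
  assumes homeo: "homeomorphic_map (gromov_compactification X d) (top_of_set (closure X)) \<Phi>"
    and Phi_Inl: "x \<in> X \<Longrightarrow> \<Phi> (Inl x) = x"
    and bounded: "bounded X"
    and frontier_nonempty: "closure X \<noteq> X"
    and dist_tendsto_0: "\<lbrakk>x \<in> X; range u \<subseteq> X; u \<longlonglongrightarrow> x\<rbrakk> \<Longrightarrow> (\<lambda>n. d x (u n)) \<longlonglongrightarrow> 0"
begin

abbreviation boundary_class :: "(real \<Rightarrow> 'a) \<Rightarrow> (real \<Rightarrow> 'a) set" where
  "boundary_class \<rho> \<equiv> asymptotic_rays X d `` {\<rho>}"

lemma topspace_compactification:
  "topspace (gromov_compactification X d) = X <+> gromov_boundary X d"
  by (rule topspace_gromov_compactification) (rule Metric_space_axioms)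

lemma inj_on_Phi: "inj_on \<Phi> (X <+> gromov_boundary X d)"
  using homeomorphic_imp_injective_map[OF homeo] by (simp add: topspace_compactification)

lemma Phi_image: "\<Phi> ` (X <+> gromov_boundary X d) = closure X"
  using homeomorphic_imp_surjective_map[OF homeo] by (simp add: topspace_compactification)

lemma Phi_boundary_notin: "\<eta> \<in> gromov_boundary X d \<Longrightarrow> \<Phi> (Inr \<eta>) \<notin> X"
  using inj_on_Phi Phi_Inl[of "\<Phi> (Inr \<eta>)"] by (force dest: inj_onD)

text \<open>By the definition of the open sets of the compactification, \<open>x\<close> converges to \<open>\<eta>\<close> in its topology;
  \<open>\<Phi>\<close> is continuous and fixes the points of \<open>X\<close>.\<close>

lemma points_tendsto_Phi:
  assumes \<eta>: "\<eta> \<in> gromov_boundary X d" and x: "range x \<subseteq> X"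
    and lim: "points_tendsto_boundary X d x \<eta>"
  shows "x \<longlonglongrightarrow> \<Phi> (Inr \<eta>)"
proof -
  have "limitin (gromov_compactification X d) (\<lambda>n. Inl (x n)) (Inr \<eta>) sequentially"
    unfolding limitin_def openin_gromov_compactification topspace_compactification
    using \<eta> x lim by (auto simp: gromov_open_def)
  from continuous_map_limit[OF homeomorphic_imp_continuous_map[OF homeo] this]
  have "limitin (top_of_set (closure X)) (\<Phi> \<circ> (\<lambda>n. Inl (x n))) (\<Phi> (Inr \<eta>)) sequentially" .
  then have "(\<Phi> \<circ> (\<lambda>n. Inl (x n))) \<longlonglongrightarrow> \<Phi> (Inr \<eta>)"
    by (simp add: limitin_subtopology)
  moreover have "\<Phi> \<circ> (\<lambda>n. Inl (x n)) = x" using x Phi_Inl by (auto simp: o_def)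
  ultimately show ?thesis by simp
qed

text \<open>If no segment joins \<open>p\<close> to \<open>x\<close>, then the constant sequence \<open>x\<close> converges vacuously to each
  boundary point \<open>\<eta>\<close>, because the condition on all choices of segments from \<open>p\<close> is empty. In the
  closure this means \<open>\<Phi> (Inr \<eta>) = x\<close>, against the injectivity of \<open>\<Phi>\<close>.\<close>

lemma geodesic_segment_exists:
  assumes p: "p \<in> X" and x: "x \<in> X"
  shows "\<exists>g. geodesic_segment X d p x g"
proof (rule ccontr)
  assume none: "\<nexists>g. geodesic_segment X d p x g"
  obtain y where y: "y \<in> closure X" "y \<notin> X" using frontier_nonempty closure_subset by blast
  then obtain w where w: "w \<in> X <+> gromov_boundary X d" "y = \<Phi> w" using Phi_image by blast
  then obtain \<eta> where \<eta>: "\<eta> \<in> gromov_boundary X d" using y(2) Phi_Inl by auto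
  have "points_tendsto_boundary X d (\<lambda>_. x) \<eta>"
    unfolding points_tendsto_boundary_def using none p by blast
  then have "(\<lambda>_::nat. x) \<longlonglongrightarrow> \<Phi> (Inr \<eta>)" using points_tendsto_Phi[OF \<eta>] x by auto
  then have "\<Phi> (Inr \<eta>) = x" by (simp add: LIMSEQ_const_iff)
  then show False using Phi_boundary_notin[OF \<eta>] x by simp
qed

text \<open>Bounded sequences do not converge to boundary points: the segments to their points, prolonged by
  constants, would be eventually constant at a common time, and so would their limit ray.\<close>

lemma gromov_open_outside_ball:
  assumes p: "p \<in> X"
  shows "gromov_open X d ({x \<in> X. R < d p x} <+> gromov_boundary X d)" (is "gromov_open X d ?W")
  unfolding gromov_open_def
proof (intro conjI allI impI)
  show "?W \<subseteq> X <+> gromov_boundary X d" by auto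
  have "Inl -` ?W = X - mcball p R" using p by auto
  then show "openin mtopology (Inl -` ?W)" by (simp add: openin_diff)
  fix \<xi> assume "Inr \<xi> \<in> ?W"
  then have \<xi>: "\<xi> \<in> gromov_boundary X d" by auto
  fix y :: "nat \<Rightarrow> 'a" assume y: "range y \<subseteq> X \<and> points_tendsto_boundary X d y \<xi>"
  show "\<forall>\<^sub>F n in sequentially. Inl (y n) \<in> ?W"
  proof (rule ccontr)
    assume "\<not> ?thesis"
    then obtain r :: "nat \<Rightarrow> nat" where r: "strict_mono r" "\<And>n. Inl (y (r n)) \<notin> ?W"
      using not_eventually_sequentiallyD by blast
    have yX: "y n \<in> X" for n using y by auto
    have yR: "d p (y (r n)) \<le> R" for n using r(2)[of n] yX[of "r n"] by auto
    obtain q where q: "q \<in> X" "\<And>\<gamma>. (\<And>n. geodesic_segment X d q (y n) (\<gamma> n)) \<Longrightarrow> subconverges_to d \<gamma> \<xi>"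
      using y unfolding points_tendsto_boundary_def by blast
    have "\<forall>n. \<exists>g. geodesic_segment X d q (y n) g" using geodesic_segment_exists q(1) yX by blast
    from choice[OF this] obtain g where g: "\<And>n. geodesic_segment X d q (y n) (g n)" by blast
    obtain s \<sigma> where s: "strict_mono (s :: nat \<Rightarrow> nat)" "\<sigma> \<in> \<xi>" "locally_uniform_limit d (g \<circ> r \<circ> s) \<sigma>"
      using q(2)[OF g] r(1) unfolding subconverges_to_def by blast
    have ray: "geodesic_ray X d \<sigma>"
      using \<xi> s(2) by (auto simp: gromov_boundary_def asymptotic_rays_def quotient_def)
    \<comment> \<open>At all times from \<open>R'\<close> on, the chosen segments rest at their ends; the ray has moved by \<open>2\<close>
      between the times \<open>R'\<close> and \<open>R' + 2\<close>.\<close>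
    define R' where "R' = d q p + R"
    have "0 \<le> R" using yR[of 0] nonneg[of p "y (r 0)"] by linarith
    then have R': "0 \<le> R'" by (simp add: R'_def)
    have "\<forall>\<^sub>F n in sequentially. \<forall>t\<in>{0..R' + 2}. d ((g \<circ> r \<circ> s) n t) (\<sigma> t) < 1"
      using s(3) unfolding locally_uniform_limit_def by (meson zero_less_one)
    from eventually_happens'[OF sequentially_bot this]
    obtain n where n: "\<And>t. t \<in> {0..R' + 2} \<Longrightarrow> d (g (r (s n)) t) (\<sigma> t) < 1"
      unfolding o_def by blast
    have "d q (y (r (s n))) \<le> R'"
      using triangle[OF q(1) p yX, of "r (s n)"] yR[of "s n"] by (simp add: R'_def)
    then have "g (r (s n)) R' = y (r (s n))" "g (r (s n)) (R' + 2) = y (r (s n))"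
      using g[of "r (s n)"] by (auto simp: geodesic_segment_def)
    then have "d (y (r (s n))) (\<sigma> R') < 1" "d (y (r (s n))) (\<sigma> (R' + 2)) < 1"
      using n[of R'] n[of "R' + 2"] R' by auto
    moreover have "\<sigma> R' \<in> X" "\<sigma> (R' + 2) \<in> X" "d (\<sigma> R') (\<sigma> (R' + 2)) = 2"
      using ray R' by (auto simp: geodesic_ray_def)
    ultimately show False
      using triangle''[of "\<sigma> R'" "y (r (s n))" "\<sigma> (R' + 2)"] yX by simp
  qed
next
  fix \<xi> \<eta> assume "range \<eta> \<subseteq> gromov_boundary X d \<and> boundary_tendsto_boundary X d \<eta> \<xi>"
  then show "\<forall>\<^sub>F n in sequentially. Inr (\<eta> n) \<in> ?W" by (intro always_eventually) auto
qed

text \<open>A subsequence converges in the closure, which is compact. Its limit is not the image of a boundary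
  point, because the latter has a neighbourhood that misses the sequence.\<close>

lemma bounded_sequence_subconverges:
  assumes p: "p \<in> X" and x: "range x \<subseteq> X" and R: "\<And>n::nat. d p (x n) \<le> R"
  shows "\<exists>l\<in>X. \<exists>r. strict_mono r \<and> (\<lambda>n. d (x (r n)) l) \<longlonglongrightarrow> 0"
proof -
  have "Elementary_Metric_Spaces.bounded (range x)" using bounded x bounded_subset by blast
  then obtain l r where r: "strict_mono (r :: nat \<Rightarrow> nat)" and lim: "(x \<circ> r) \<longlonglongrightarrow> l"
    using bounded_imp_convergent_subsequence by blast
  have xX: "x n \<in> X" for n using x by auto
  have l: "l \<in> closure X"
    unfolding closure_sequential using lim xX by (intro exI[of _ "x \<circ> r"]) auto
  have "l \<in> X"
  proof (rule ccontr)
    assume "l \<notin> X"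
    then obtain \<eta> where \<eta>: "\<eta> \<in> gromov_boundary X d" "l = \<Phi> (Inr \<eta>)"
      using l Phi_Inl by (auto simp flip: Phi_image)
    define W where "W = {x \<in> X. R < d p x} <+> gromov_boundary X d"
    have "openin (top_of_set (closure X)) (\<Phi> ` W)"
      using homeomorphic_imp_open_map[OF homeo] gromov_open_outside_ball[OF p, of R]
      by (auto simp: open_map_def openin_gromov_compactification W_def)
    then obtain T where T: "open T" "\<Phi> ` W = closure X \<inter> T" by (auto simp: openin_open)
    have "l \<in> T" using \<eta> T(2) by (auto simp: W_def)
    then have "\<forall>\<^sub>F n in sequentially. (x \<circ> r) n \<in> T" using lim T(1) by (metis topological_tendstoD)
    from eventually_happens'[OF sequentially_bot this]
    obtain n where n: "x (r n) \<in> T" by auto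
    then have "x (r n) \<in> \<Phi> ` W" using T(2) subsetD[OF closure_subset xX] by auto
    then obtain w where w: "w \<in> W" "x (r n) = \<Phi> w" by blast
    then have "\<Phi> w = \<Phi> (Inl (x (r n)))" using Phi_Inl[OF xX[of "r n"]] by simp
    moreover have "w \<in> X <+> gromov_boundary X d" "Inl (x (r n)) \<in> X <+> gromov_boundary X d"
      using w(1) xX by (auto simp: W_def)
    ultimately have "w = Inl (x (r n))" using inj_on_Phi by (meson inj_onD)
    then have "R < d p (x (r n))" using w(1) by (auto simp: W_def)
    with R[of "r n"] show False by simp
  qed
  moreover have "(\<lambda>n. d l ((x \<circ> r) n)) \<longlonglongrightarrow> 0"
    using dist_tendsto_0[OF \<open>l \<in> X\<close> _ lim] xX by auto
  ultimately show ?thesis using r by (auto simp: o_def commute)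
qed

sublocale proper_metric_space X d
  by unfold_locales (rule bounded_sequence_subconverges)

end

locale gromov_hyperbolic_model = gromov_model X d \<Phi> + gromov_hyperbolic_space X d \<delta>
  for X :: "'a::heine_borel set" and d \<Phi> \<delta>
begin

sublocale proper_gromov_hyperbolic_space X d \<delta> ..

text \<open>The ray is a limit of segments from \<open>\<alpha> 0\<close> to \<open>\<alpha> (r n)\<close>. It is near \<open>\<alpha>\<close> because these segments are,
  uniformly in \<open>n\<close>, and its class goes to \<open>\<xi>\<close> because the points \<open>\<alpha> (r n)\<close> tend to both.\<close>

lemma quasigeodesic_shadows_ray:
  assumes alpha: "\<And>t. 0 \<le> t \<Longrightarrow> \<alpha> t \<in> X"
    and upper: "\<And>s t. \<lbrakk>0 \<le> s; 0 \<le> t\<rbrakk> \<Longrightarrow> d (\<alpha> s) (\<alpha> t) \<le> L * \<bar>s - t\<bar>"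
    and lower: "\<And>s t. \<lbrakk>0 \<le> s; 0 \<le> t\<rbrakk> \<Longrightarrow> \<bar>s - t\<bar> \<le> d (\<alpha> s) (\<alpha> t)"
    and L: "0 \<le> L" and lands: "(\<alpha> \<longlongrightarrow> \<xi>) at_top"
  obtains \<rho> C where "geodesic_ray X d \<rho>" "\<Phi> (Inr (boundary_class \<rho>)) = \<xi>"
    "\<forall>t\<ge>0. \<exists>u\<ge>0. d (\<alpha> t) (\<rho> u) \<le> C" "\<forall>u\<ge>0. \<exists>t\<ge>0. d (\<rho> u) (\<alpha> t) \<le> C"
proof -
  obtain K where K: "\<And>\<alpha> b g u. \<lbrakk>\<And>t. 0 \<le> t \<Longrightarrow> \<alpha> t \<in> X;
      \<And>s t. \<lbrakk>0 \<le> s; 0 \<le> t\<rbrakk> \<Longrightarrow> d (\<alpha> s) (\<alpha> t) \<le> L * \<bar>s - t\<bar>;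
      \<And>s t. \<lbrakk>0 \<le> s; 0 \<le> t\<rbrakk> \<Longrightarrow> \<bar>s - t\<bar> \<le> d (\<alpha> s) (\<alpha> t);
      0 \<le> b; geodesic_segment X d (\<alpha> 0) (\<alpha> b) g; u \<in> {0..d (\<alpha> 0) (\<alpha> b)}\<rbrakk> \<Longrightarrow>
      \<exists>t\<in>{0..b}. d (g u) (\<alpha> t) \<le> K"
    by (rule geodesic_near_quasigeodesic[OF L]) blast
  define x where "x n = \<alpha> (real n)" for n
  have x: "x n \<in> X" for n using alpha by (simp add: x_def)
  have p: "\<alpha> 0 \<in> X" using alpha by simp
  have "\<forall>n. \<exists>g. geodesic_segment X d (\<alpha> 0) (x n) g" using geodesic_segment_exists p x by blast
  from choice[OF this] obtain g where g: "\<And>n. geodesic_segment X d (\<alpha> 0) (x n) (g n)" by blast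
  have "real n \<le> d (\<alpha> 0) (x n)" for n using lower[of 0 "real n"] by (simp add: x_def)
  then have far: "filterlim (\<lambda>n. d (\<alpha> 0) (x n)) at_top sequentially"
    by (intro filterlim_at_top_mono[OF filterlim_real_sequentially]) simp
  obtain r \<rho> where r: "strict_mono (r :: nat \<Rightarrow> nat)" and \<rho>: "geodesic_ray X d \<rho>"
    and lim: "locally_uniform_limit d (g \<circ> r) \<rho>"
    and tends: "points_tendsto_boundary X d (x \<circ> r) (boundary_class \<rho>)"
    by (rule points_subconverge_to_boundary[where x = x and g = g, OF p x g far])
  have cls: "boundary_class \<rho> \<in> gromov_boundary X d"
    using \<rho> by (auto simp: gromov_boundary_def intro: quotientI)
  have "(x \<circ> r) \<longlonglongrightarrow> \<Phi> (Inr (boundary_class \<rho>))"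
    using points_tendsto_Phi[OF cls _ tends] x by auto
  moreover have "x \<longlonglongrightarrow> \<xi>"
    unfolding x_def by (rule filterlim_compose[OF lands filterlim_real_sequentially])
  then have "(x \<circ> r) \<longlonglongrightarrow> \<xi>" using r by (rule LIMSEQ_subseq_LIMSEQ)
  ultimately have \<xi>: "\<Phi> (Inr (boundary_class \<rho>)) = \<xi>" by (rule LIMSEQ_unique)
  have near: "\<exists>t\<ge>0. d (\<rho> u) (\<alpha> t) \<le> K + 1" if u: "0 \<le> u" for u
  proof -
    have "\<forall>\<^sub>F n in sequentially. \<forall>t\<in>{0..u}. d ((g \<circ> r) n t) (\<rho> t) < 1"
      using lim unfolding locally_uniform_limit_def by (meson zero_less_one)
    moreover have "\<forall>\<^sub>F n in sequentially. u \<le> d (\<alpha> 0) (x (r n))"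
      using filterlim_compose[OF far filterlim_subseq[OF r]] unfolding filterlim_at_top by blast
    ultimately have "\<forall>\<^sub>F n in sequentially. d (g (r n) u) (\<rho> u) < 1 \<and> u \<le> d (\<alpha> 0) (x (r n))"
      by eventually_elim (use u in auto)
    from eventually_happens'[OF sequentially_bot this]
    obtain n where n: "d (g (r n) u) (\<rho> u) < 1" "u \<le> d (\<alpha> 0) (x (r n))" by blast
    obtain t where t: "t \<in> {0..real (r n)}" "d (g (r n) u) (\<alpha> t) \<le> K"
      using K[of \<alpha> "real (r n)" "g (r n)" u, OF alpha upper lower] g[of "r n"] n(2) u
      by (auto simp: x_def)
    have "g (r n) u \<in> X" using geodesic_segment_prolonged(2)[OF g u] .
    then have "d (\<rho> u) (\<alpha> t) \<le> K + 1"
      using triangle''[of "\<rho> u" "g (r n) u" "\<alpha> t"] \<rho> u alpha t n(1) by (auto simp: geodesic_ray_def)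
    then show ?thesis using t(1) by auto
  qed
  obtain C where C: "\<And>t. 0 \<le> t \<Longrightarrow> \<exists>u\<ge>0. d (\<alpha> t) (\<rho> u) \<le> C"
    using quasigeodesic_near_shadowed_ray[OF alpha upper lower L \<rho> near] by blast
  show thesis
  proof (rule that[OF \<rho> \<xi>, of "max C (K + 1)"])
    show "\<forall>t\<ge>0. \<exists>u\<ge>0. d (\<alpha> t) (\<rho> u) \<le> max C (K + 1)"
      using C by (meson max.coboundedI1)
    show "\<forall>u\<ge>0. \<exists>t\<ge>0. d (\<rho> u) (\<alpha> t) \<le> max C (K + 1)"
      using near by (meson max.coboundedI2)
  qed
qed

text \<open>The two shadowed rays have the same image under \<open>\<Phi>\<close>, hence the same class: they are asymptotic,
  and connect \<open>\<alpha>\<close> to \<open>\<beta>\<close>.\<close>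

lemma quasigeodesics_landing_together_close:
  assumes alpha: "\<And>t. 0 \<le> t \<Longrightarrow> \<alpha> t \<in> X" "\<And>s t. \<lbrakk>0 \<le> s; 0 \<le> t\<rbrakk> \<Longrightarrow> d (\<alpha> s) (\<alpha> t) \<le> L * \<bar>s - t\<bar>"
      "\<And>s t. \<lbrakk>0 \<le> s; 0 \<le> t\<rbrakk> \<Longrightarrow> \<bar>s - t\<bar> \<le> d (\<alpha> s) (\<alpha> t)" "0 \<le> L" "(\<alpha> \<longlongrightarrow> \<xi>) at_top"
    and beta: "\<And>t. 0 \<le> t \<Longrightarrow> \<beta> t \<in> X" "\<And>s t. \<lbrakk>0 \<le> s; 0 \<le> t\<rbrakk> \<Longrightarrow> d (\<beta> s) (\<beta> t) \<le> L' * \<bar>s - t\<bar>"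
      "\<And>s t. \<lbrakk>0 \<le> s; 0 \<le> t\<rbrakk> \<Longrightarrow> \<bar>s - t\<bar> \<le> d (\<beta> s) (\<beta> t)" "0 \<le> L'" "(\<beta> \<longlongrightarrow> \<xi>) at_top"
  shows "\<exists>C. \<forall>t\<ge>0. \<exists>s\<ge>0. d (\<alpha> t) (\<beta> s) \<le> C"
proof -
  obtain \<rho> C where \<rho>: "geodesic_ray X d \<rho>" "\<Phi> (Inr (boundary_class \<rho>)) = \<xi>"
    and C: "\<forall>t\<ge>0. \<exists>u\<ge>0. d (\<alpha> t) (\<rho> u) \<le> C"
    and "\<forall>u\<ge>0. \<exists>t\<ge>0. d (\<rho> u) (\<alpha> t) \<le> C"
    by (rule quasigeodesic_shadows_ray[OF alpha])
  obtain \<rho>' C' where \<rho>': "geodesic_ray X d \<rho>'" "\<Phi> (Inr (boundary_class \<rho>')) = \<xi>"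
    and "\<forall>t\<ge>0. \<exists>u\<ge>0. d (\<beta> t) (\<rho>' u) \<le> C'"
    and C': "\<forall>u\<ge>0. \<exists>t\<ge>0. d (\<rho>' u) (\<beta> t) \<le> C'"
    by (rule quasigeodesic_shadows_ray[OF beta])
  have "boundary_class \<rho> \<in> gromov_boundary X d" "boundary_class \<rho>' \<in> gromov_boundary X d"
    using \<rho>(1) \<rho>'(1) by (auto simp: gromov_boundary_def intro: quotientI)
  then have "boundary_class \<rho> = boundary_class \<rho>'"
    using inj_onD[OF inj_on_Phi, of "Inr (boundary_class \<rho>)" "Inr (boundary_class \<rho>')"] \<rho>(2) \<rho>'(2)
    by auto
  moreover have "\<rho>' \<in> boundary_class \<rho>'"
  proof -
    have "d (\<rho>' t) (\<rho>' t) = 0" if "0 \<le> t" for t using \<rho>'(1) that by (simp add: geodesic_ray_def)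
    then show ?thesis
      using \<rho>'(1) by (auto simp: asymptotic_rays_def intro!: bdd_aboveI2[where M = 0])
  qed
  ultimately have "bdd_above ((\<lambda>t. d (\<rho> t) (\<rho>' t)) ` {0..})" by (auto simp: asymptotic_rays_def)
  then obtain B where B: "\<And>t. 0 \<le> t \<Longrightarrow> d (\<rho> t) (\<rho>' t) \<le> B" by (auto simp: bdd_above_def)
  have "\<exists>s\<ge>0. d (\<alpha> t) (\<beta> s) \<le> C + B + C'" if t: "0 \<le> t" for t
  proof -
    obtain u where u: "0 \<le> u" "d (\<alpha> t) (\<rho> u) \<le> C" using C t by blast
    obtain s where s: "0 \<le> s" "d (\<rho>' u) (\<beta> s) \<le> C'" using C' u(1) by blast
    have "\<rho> u \<in> X" "\<rho>' u \<in> X" using \<rho>(1) \<rho>'(1) u(1) by (auto simp: geodesic_ray_def)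
    then have "d (\<alpha> t) (\<beta> s) \<le> d (\<alpha> t) (\<rho> u) + (d (\<rho> u) (\<rho>' u) + d (\<rho>' u) (\<beta> s))"
      using triangle[of "\<alpha> t" "\<rho> u" "\<beta> s"] triangle[of "\<rho> u" "\<rho>' u" "\<beta> s"] alpha(1)[OF t] beta(1)[OF s(1)]
      by simp
    then show ?thesis using u s B[OF u(1)] by (intro exI[of _ s]) simp
  qed
  then show ?thesis by blast
qed

end

section \<open>Chains of centred discs\<close>

text \<open>The chains in the definition of the Kobayashi distance, normalised so that each disc starts at its
  centre. Automorphisms of the unit disc show that nothing is lost (\<open>kobayashi_dist_eq_Inf\<close>). Centred
  discs can be restricted to smaller concentric discs, and arguments about the first disc of a chain
  that has some property become inductions. The last argument is the length of the chain.\<close>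

inductive disc_chain :: "(complex ^ 'n) set \<Rightarrow> complex ^ 'n \<Rightarrow> complex ^ 'n \<Rightarrow> real \<Rightarrow> bool"
  for \<Omega> where
  refl: "disc_chain \<Omega> x x 0"
| step: "\<lbrakk>holomorphic_disc \<Omega> f; cmod w < 1; disc_chain \<Omega> (f w) y l\<rbrakk> \<Longrightarrow>
    disc_chain \<Omega> (f 0) y (artanh (cmod w) + l)"

lemma artanh_nonneg: "0 \<le> artanh x" if "0 \<le> x" "x < 1" for x :: real
  using that by (simp add: artanh_def)

lemma artanh_mono: "artanh x \<le> artanh y" if "0 \<le> x" "x \<le> y" "y < 1" for x y :: real
  using that by (simp add: artanh_def frac_le)

lemma artanh_ge_half: "x / 2 \<le> artanh x" if "0 \<le> x" "x < 1" for x :: real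
proof -
  have "ln ((1 - x) / (1 + x)) \<le> (1 - x) / (1 + x) - 1"
    using that by (intro ln_le_minus_one) simp
  then have "2 * x / (1 + x) \<le> 2 * artanh x"
    using that by (simp add: artanh_def ln_div field_simps)
  moreover have "x \<le> 2 * x / (1 + x)"
    using that by (simp add: field_simps mult_left_le)
  ultimately show ?thesis by simp
qed

lemma artanh_le_double: "artanh x \<le> 2 * x" if "0 \<le> x" "x \<le> 1 / 2" for x :: real
proof -
  have "ln ((1 + x) / (1 - x)) \<le> (1 + x) / (1 - x) - 1"
    using that by (intro ln_le_minus_one) simp
  also have "\<dots> = 2 * x / (1 - x)" using that by (simp add: field_simps)
  also have "\<dots> \<le> 2 * x / (1 / 2)" using that by (intro divide_left_mono) auto
  finally show ?thesis by (simp add: artanh_def)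
qed

lemma disc_chain_nonneg: "disc_chain \<Omega> x y l \<Longrightarrow> 0 \<le> l"
  by (induction rule: disc_chain.induct) (auto intro!: add_nonneg_nonneg artanh_nonneg)

lemma disc_chain_trans:
  "disc_chain \<Omega> x y l \<Longrightarrow> disc_chain \<Omega> y z l' \<Longrightarrow> disc_chain \<Omega> x z (l + l')"
  by (induction rule: disc_chain.induct) (auto simp: add.assoc intro: disc_chain.step)

lemma disc_chain_disc:
  assumes "holomorphic_disc \<Omega> f" "cmod w < 1"
  shows "disc_chain \<Omega> (f 0) (f w) (artanh (cmod w))"
  using disc_chain.step[OF assms disc_chain.refl] by simp

lemma disc_chain_mono: "disc_chain A x y l \<Longrightarrow> A \<subseteq> B \<Longrightarrow> disc_chain B x y l"
proof (induction rule: disc_chain.induct)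
  case (step f w y l)
  then have "holomorphic_disc B f" by (auto simp: holomorphic_disc_def)
  with step show ?case by (auto intro: disc_chain.step)
qed (rule disc_chain.refl)

lemma disc_chain_in:
  assumes "disc_chain \<Omega> x y l" "x \<in> \<Omega>"
  shows "y \<in> \<Omega>"
  using assms
proof (induction rule: disc_chain.induct)
  case (step f w y l)
  then show ?case by (simp add: holomorphic_disc_def image_subset_iff)
qed

lemma holomorphic_disc_compose:
  assumes f: "holomorphic_disc \<Omega> f" and \<phi>: "\<phi> holomorphic_on ball 0 1" "\<phi> ` ball 0 1 \<subseteq> ball 0 1"
  shows "holomorphic_disc \<Omega> (\<lambda>z. f (\<phi> z))"
proof -
  have "((\<lambda>z. f z $ i) \<circ> \<phi>) holomorphic_on ball 0 1" for i
    by (rule holomorphic_on_compose_gen[OF \<phi>(1) _ \<phi>(2)])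
      (use f in \<open>auto simp: holomorphic_disc_def\<close>)
  then show ?thesis
    using f \<phi>(2) by (auto simp: holomorphic_disc_def o_def image_subset_iff)
qed

text \<open>Precompose with the automorphism of the disc that sends \<open>0\<close> to \<open>a\<close>.\<close>

lemma disc_chain_poincare_dist:
  assumes f: "holomorphic_disc \<Omega> f" and a: "a \<in> ball 0 1" and b: "b \<in> ball 0 1"
  shows "disc_chain \<Omega> (f a) (f b) (poincare_dist a b)"
proof -
  define \<phi> where "\<phi> = Moebius_function 0 (- a)"
  define w where "w = Moebius_function 0 a b"
  have a1: "cmod a < 1" "cmod b < 1" using a b by auto
  have w: "cmod w < 1" unfolding w_def using a1 by (rule Moebius_function_norm_lt_1)
  have "holomorphic_disc \<Omega> (\<lambda>z. f (\<phi> z))"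
    unfolding \<phi>_def using a1 Moebius_function_norm_lt_1[of "- a"]
    by (intro holomorphic_disc_compose[OF f] Moebius_function_holomorphic) auto
  from disc_chain_disc[OF this w]
  have "disc_chain \<Omega> (f (\<phi> 0)) (f (\<phi> w)) (artanh (cmod w))" .
  moreover have "\<phi> 0 = a" by (simp add: \<phi>_def Moebius_function_of_zero)
  moreover have "\<phi> w = b"
    unfolding \<phi>_def w_def using a1 by (intro Moebius_function_compose) auto
  moreover have "cmod w = cmod ((a - b) / (1 - cnj b * a))"
  proof -
    have "cnj (1 - cnj b * a) = 1 - cnj a * b" by (simp add: mult.commute)
    then have "cmod (1 - cnj a * b) = cmod (1 - cnj b * a)" by (metis complex_mod_cnj)
    then show ?thesis
      by (simp add: w_def Moebius_function_simple norm_divide norm_minus_commute)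
  qed
  ultimately show ?thesis by (simp add: poincare_dist_def)
qed

lemma kobayashi_dist_eq_Inf:
  assumes "x \<in> \<Omega>" "y \<in> \<Omega>"
  shows "kobayashi_dist \<Omega> x y = Inf {l. disc_chain \<Omega> x y l}"
proof -
  define C where "C n p f a b \<longleftrightarrow> (\<forall>i<n. holomorphic_disc \<Omega> (f i) \<and> a i \<in> ball 0 1 \<and> b i \<in> ball 0 1 \<and>
     f i (a i) = p i \<and> f i (b i) = p (Suc i))"
    for n and p :: "nat \<Rightarrow> complex ^ 'a" and f and a b :: "nat \<Rightarrow> complex"
  have 1: "disc_chain \<Omega> (p 0) (p n) (\<Sum>i<n. poincare_dist (a i) (b i))" if "C n p f a b" for n p f a b
    using that
  proof (induction n)
    case 0
    then show ?case by (simp add: disc_chain.refl)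
  next
    case (Suc n)
    then have "C n p f a b" by (simp add: C_def)
    then have "disc_chain \<Omega> (p 0) (p n) (\<Sum>i<n. poincare_dist (a i) (b i))" by (rule Suc.IH)
    moreover have "disc_chain \<Omega> (f n (a n)) (f n (b n)) (poincare_dist (a n) (b n))"
      by (rule disc_chain_poincare_dist) (use Suc.prems in \<open>auto simp: C_def\<close>)
    moreover have "f n (a n) = p n" "f n (b n) = p (Suc n)"
      using Suc.prems by (auto simp: C_def)
    ultimately show ?case using disc_chain_trans by fastforce
  qed
  have 2: "\<exists>n p f a b. C n p f a b \<and> p 0 = x \<and> p n = y \<and> l = (\<Sum>i<n. poincare_dist (a i) (b i))"
    if "disc_chain \<Omega> x y l" for l x y
    using that
  proof (induction rule: disc_chain.induct)
    case (refl x)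
    show ?case by (rule exI[of _ 0], rule exI[of _ "\<lambda>_. x"]) (simp add: C_def)
  next
    case (step g w y l)
    then obtain n p f a b where c: "C n p f a b" "p 0 = g w" "p n = y"
      "l = (\<Sum>i<n. poincare_dist (a i) (b i))" by blast
    define p' where "p' i = (case i of 0 \<Rightarrow> g 0 | Suc j \<Rightarrow> p j)" for i
    define f' where "f' i = (case i of 0 \<Rightarrow> g | Suc j \<Rightarrow> f j)" for i
    define a' where "a' i = (case i of 0 \<Rightarrow> 0 | Suc j \<Rightarrow> a j)" for i
    define b' where "b' i = (case i of 0 \<Rightarrow> w | Suc j \<Rightarrow> b j)" for i
    have "C (Suc n) p' f' a' b'"
      using c step.hyps by (auto simp: C_def p'_def f'_def a'_def b'_def split: nat.splits)
    moreover have "p' 0 = g 0" "p' (Suc n) = y" using c by (auto simp: p'_def)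
    moreover have "artanh (cmod w) + l = (\<Sum>i<Suc n. poincare_dist (a' i) (b' i))"
      unfolding sum.lessThan_Suc_shift using c by (simp add: a'_def b'_def poincare_dist_def)
    ultimately show ?case by blast
  qed
  have "{(\<Sum>i<n. poincare_dist (a i) (b i)) | (n :: nat) p f a b. p 0 = x \<and> p n = y \<and>
      (\<forall>i<n. holomorphic_disc \<Omega> (f i) \<and> a i \<in> ball 0 1 \<and> b i \<in> ball 0 1 \<and>
         f i (a i) = p i \<and> f i (b i) = p (Suc i))} = {l. disc_chain \<Omega> x y l}"
    (is "?A = _")
  proof (intro set_eqI iffI)
    fix l assume "l \<in> ?A"
    then show "l \<in> {l. disc_chain \<Omega> x y l}" using 1 unfolding C_def by blast
  next
    fix l assume "l \<in> {l. disc_chain \<Omega> x y l}"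
    then show "l \<in> ?A" using 2[of x y l] unfolding C_def by blast
  qed
  then show ?thesis using assms by (simp add: kobayashi_dist_def)
qed

lemma bdd_below_disc_chain: "bdd_below {l. disc_chain \<Omega> x y l}"
  using disc_chain_nonneg by (intro bdd_belowI[of _ 0]) auto

lemma kobayashi_dist_le_disc_chain:
  assumes "disc_chain \<Omega> x y l" "x \<in> \<Omega>"
  shows "kobayashi_dist \<Omega> x y \<le> l"
proof -
  have "Inf {l. disc_chain \<Omega> x y l} \<le> l"
    by (rule cInf_lower) (use assms(1) bdd_below_disc_chain in auto)
  then show ?thesis using assms disc_chain_in[OF assms] by (simp add: kobayashi_dist_eq_Inf)
qed

lemma norm_scaled_vector: "norm (\<chi> i. z * v $ i) = cmod z * norm (v :: complex ^ 'n)"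
  by (simp add: norm_vec_def norm_mult L2_set_right_distrib)

text \<open>The affine disc in the complex line through \<open>x\<close> and \<open>y\<close>.\<close>

lemma disc_chain_ball:
  assumes ball: "ball x r \<subseteq> \<Omega>" and y: "y \<in> ball x r"
  shows "disc_chain \<Omega> x y (artanh (dist x y / r))" "disc_chain \<Omega> y x (artanh (dist x y / r))"
proof -
  have r: "0 < r" using y by (metis ball_empty empty_iff not_le)
  define \<rho> where "\<rho> = dist x y / r"
  have \<rho>: "0 \<le> \<rho>" "\<rho> < 1" using y r by (auto simp: \<rho>_def)
  define v where "v = (r / dist x y) *\<^sub>R (y - x)"
  define f where "f z = x + (\<chi> i. z * v $ i)" for z :: complex
  have v: "norm v \<le> r" using r by (simp add: v_def dist_norm norm_minus_commute)
  have "f z \<in> ball x r" if "cmod z < 1" for z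
  proof -
    have "dist x (f z) = cmod z * norm v" by (simp add: f_def dist_norm norm_scaled_vector)
    also have "\<dots> \<le> cmod z * r" using v by (intro mult_left_mono) auto
    also have "\<dots> < r" using that r by simp
    finally show ?thesis by simp
  qed
  then have disc: "holomorphic_disc \<Omega> f"
    using ball by (auto simp: holomorphic_disc_def f_def intro!: holomorphic_intros)
  have f0: "f 0 = x" by (simp add: f_def vec_eq_iff)
  have f1: "f (of_real \<rho>) = y"
  proof -
    have "of_real \<rho> * v $ i = y $ i - x $ i" for i
    proof -
      have "of_real \<rho> * v $ i = of_real (\<rho> * (r / dist x y)) * (y $ i - x $ i)"
        by (simp add: v_def scaleR_conv_of_real[where 'a = complex])
      moreover have "\<rho> * (r / dist x y) = 1" if "x \<noteq> y" using r that by (simp add: \<rho>_def)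
      ultimately show ?thesis
        by (cases "x = y") (simp, simp only: not_False_eq_True of_real_1 mult_1_left)
    qed
    then show ?thesis by (simp add: f_def vec_eq_iff)
  qed
  have P: "poincare_dist 0 (of_real \<rho>) = artanh \<rho>" "poincare_dist (of_real \<rho>) 0 = artanh \<rho>"
    using \<rho> by (auto simp: poincare_dist_def)
  have "complex_of_real \<rho> \<in> ball 0 1" using \<rho> by simp
  then show "disc_chain \<Omega> x y (artanh (dist x y / r))" "disc_chain \<Omega> y x (artanh (dist x y / r))"
    using disc_chain_poincare_dist[OF disc, of 0 "of_real \<rho>"]
      disc_chain_poincare_dist[OF disc, of "of_real \<rho>" 0] f0 f1 P by (auto simp: \<rho>_def)
qed

text \<open>By \<open>disc_chain_ball\<close>, the points that can be joined to a given one form an open set, and so do those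
  that cannot.\<close>

lemma disc_chain_exists:
  assumes "open \<Omega>" "connected \<Omega>" "x \<in> \<Omega>" "y \<in> \<Omega>"
  shows "\<exists>l. disc_chain \<Omega> x y l"
proof -
  have "(\<exists>l. disc_chain \<Omega> x y l) \<and> (\<exists>l. disc_chain \<Omega> y x l)"
  proof (rule connected_equivalence_relation[OF assms(2-4),
        where R = "\<lambda>x y. (\<exists>l. disc_chain \<Omega> x y l) \<and> (\<exists>l. disc_chain \<Omega> y x l)"])
    fix a assume "a \<in> \<Omega>"
    then obtain e where e: "0 < e" "ball a e \<subseteq> \<Omega>" using assms(1) by (meson openE)
    then have "openin (top_of_set \<Omega>) (ball a e)"
      by (simp add: assms(1) openin_open_eq)
    then show "\<exists>T. openin (top_of_set \<Omega>) T \<and> a \<in> T \<and>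
        (\<forall>x\<in>T. (\<exists>l. disc_chain \<Omega> a x l) \<and> (\<exists>l. disc_chain \<Omega> x a l))"
      using disc_chain_ball[OF e(2)] e(1) by (intro exI[of _ "ball a e"]) (auto; blast)
  qed (blast dest: disc_chain_trans)+
  then show ?thesis by blast
qed

lemma disc_chain_approximates:
  assumes "open \<Omega>" "connected \<Omega>" "x \<in> \<Omega>" "y \<in> \<Omega>" "kobayashi_dist \<Omega> x y < c"
  obtains l where "disc_chain \<Omega> x y l" "l < c"
proof -
  have "{l. disc_chain \<Omega> x y l} \<noteq> {}" using disc_chain_exists[OF assms(1-4)] by simp
  moreover have "Inf {l. disc_chain \<Omega> x y l} < c"
    using assms(5) by (simp add: kobayashi_dist_eq_Inf[OF assms(3,4)])
  ultimately have "\<exists>l\<in>{l. disc_chain \<Omega> x y l}. l < c" by (rule cInf_lessD)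
  then show thesis using that by (elim bexE CollectE)
qed

lemma kobayashi_dist_antimono:
  assumes "open A" "connected A" "A \<subseteq> B" "x \<in> A" "y \<in> A"
  shows "kobayashi_dist B x y \<le> kobayashi_dist A x y"
proof (rule field_le_epsilon)
  fix e :: real assume "0 < e"
  then have "kobayashi_dist A x y < kobayashi_dist A x y + e" by simp
  then obtain l where l: "disc_chain A x y l" "l < kobayashi_dist A x y + e"
    by (rule disc_chain_approximates[OF assms(1,2,4,5)])
  then have "kobayashi_dist B x y \<le> l"
    using assms(3,4) by (intro kobayashi_dist_le_disc_chain[OF disc_chain_mono[OF l(1)]]) auto
  with l(2) show "kobayashi_dist B x y \<le> kobayashi_dist A x y + e" by simp
qed

lemma kobayashi_dist_tendsto_0:
  assumes "kobayashi_hyperbolic \<Omega>" "open \<Omega>" "x \<in> \<Omega>" "u \<longlonglongrightarrow> x"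
  shows "(\<lambda>n. kobayashi_dist \<Omega> x (u n)) \<longlonglongrightarrow> 0"
proof -
  obtain r where r: "0 < r" "ball x r \<subseteq> \<Omega>" using assms(2,3) by (meson openE)
  have "(\<lambda>n. artanh (dist x (u n) / r)) \<longlonglongrightarrow> artanh (dist x x / r)"
    using assms(4) by (intro tendsto_intros) (use r in auto)
  moreover have "\<forall>\<^sub>F n in sequentially. u n \<in> ball x r"
    using assms(4) r(1) by (auto dest: tendstoD simp: dist_commute)
  then have "\<forall>\<^sub>F n in sequentially. kobayashi_dist \<Omega> x (u n) \<le> artanh (dist x (u n) / r)"
    by eventually_elim (rule kobayashi_dist_le_disc_chain[OF disc_chain_ball(1)[OF r(2)] assms(3)])
  moreover have "0 \<le> kobayashi_dist \<Omega> x y" for y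
    using assms(1) unfolding kobayashi_hyperbolic_def by (rule Metric_space.nonneg)
  ultimately show ?thesis
    using tendsto_sandwich[of "\<lambda>_. 0" "\<lambda>n. kobayashi_dist \<Omega> x (u n)" sequentially
        "\<lambda>n. artanh (dist x (u n) / r)" 0] by (simp add: artanh_def)
qed


section \<open>Localization of the Kobayashi distance\<close>

lemma holomorphic_disc_continuous_on:
  assumes "holomorphic_disc \<Omega> f"
  shows "continuous_on (ball 0 1) f"
proof -
  have "continuous_on (ball 0 1) (\<lambda>z. \<chi> i. f z $ i)"
    using assms by (intro continuous_on_vec_lambda holomorphic_on_imp_continuous_on)
      (simp add: holomorphic_disc_def)
  then show ?thesis by simp
qed

text \<open>The first disc that leaves the ball is cut at a point of the radius from \<open>0\<close> to \<open>w\<close> that goes to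
  the sphere; centred discs make it evident that the chain does not get longer.\<close>

lemma disc_chain_crosses_sphere:
  assumes "disc_chain \<Omega> x y l" "dist \<xi> x < r" "r \<le> dist \<xi> y"
  shows "\<exists>z l'. disc_chain \<Omega> x z l' \<and> l' \<le> l \<and> dist \<xi> z = r"
  using assms
proof (induction rule: disc_chain.induct)
  case (refl x)
  then show ?case by simp
next
  case (step f w y l)
  show ?case
  proof (cases "dist \<xi> (f w) < r")
    case True
    then obtain z l' where "disc_chain \<Omega> (f w) z l'" "l' \<le> l" "dist \<xi> z = r"
      using step by blast
    then show ?thesis
      using disc_chain.step[OF step.hyps(1,2)]
      by (intro exI[of _ z] exI[of _ "artanh (cmod w) + l'"]) auto
  next
    case False
    have in_ball: "complex_of_real t * w \<in> ball 0 1" if "t \<in> {0..1}" for t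
    proof -
      have "\<bar>t\<bar> * cmod w \<le> 1 * cmod w" using that by (intro mult_right_mono) auto
      then show ?thesis using step.hyps(2) by (simp add: norm_mult)
    qed
    have "continuous_on {0..1} (\<lambda>t. dist \<xi> (f (complex_of_real t * w)))"
      by (intro continuous_intros continuous_on_compose2[OF holomorphic_disc_continuous_on[OF step.hyps(1)]])
        (use in_ball in auto)
    then obtain t where t: "0 \<le> t" "t \<le> 1" "dist \<xi> (f (complex_of_real t * w)) = r"
      using IVT'[of "\<lambda>t. dist \<xi> (f (complex_of_real t * w))" 0 r 1] step.prems(1) False by auto
    have "cmod (complex_of_real t * w) \<le> cmod w"
      using t by (simp add: norm_mult mult_left_le_one_le)
    then have "artanh (cmod (complex_of_real t * w)) \<le> artanh (cmod w)"
      using step.hyps(2) by (intro artanh_mono) auto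
    moreover have "disc_chain \<Omega> (f 0) (f (complex_of_real t * w)) (artanh (cmod (complex_of_real t * w)))"
      using in_ball[of t] t by (intro disc_chain_disc step.hyps(1)) auto
    ultimately show ?thesis
      using t(3) disc_chain_nonneg[OF step.hyps(3)]
      by (intro exI[of _ "f (complex_of_real t * w)"] exI[of _ "artanh (cmod (complex_of_real t * w))"]) auto
  qed
qed

text \<open>Each disc \<open>f\<close> of the chain is replaced by \<open>z \<mapsto> f (r * z)\<close>. Its points can be reached from \<open>x\<close> by
  chains of length less than \<open>l + artanh r < c\<close>, so that it lies in \<open>U\<close>. The parameter \<open>w\<close> of its
  end becomes \<open>w / r\<close>; as \<open>l \<le> r / 4\<close> forces \<open>cmod w \<le> r / 2\<close>, this is in the range in which \<open>artanh\<close>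
  is comparable to the identity. In the induction the part of the chain that has been used is
  subtracted from \<open>c\<close>.\<close>

lemma disc_chain_localize:
  assumes "disc_chain \<Omega> x y l" and r: "0 < r" "r < 1" and "l \<le> r / 4" "l + artanh r < c"
    and "\<And>z m. \<lbrakk>disc_chain \<Omega> x z m; m < c\<rbrakk> \<Longrightarrow> z \<in> U"
  shows "\<exists>m \<le> (4 / r) * l. disc_chain (U \<inter> \<Omega>) x y m"
  using assms(1,4-)
proof (induction arbitrary: c rule: disc_chain.induct)
  case (refl x)
  show ?case by (intro exI[of _ 0]) (simp add: disc_chain.refl)
next
  case (step f w y l)
  define s where "s = artanh (cmod w)"
  have s: "cmod w / 2 \<le> s" "0 \<le> s" "0 \<le> l"
    unfolding s_def using step.hyps(2) artanh_ge_half artanh_nonneg disc_chain_nonneg[OF step.hyps(3)]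
    by auto
  have "\<exists>m \<le> (4 / r) * l. disc_chain (U \<inter> \<Omega>) (f w) y m"
  proof (rule step.IH[of "c - s"])
    show "l \<le> r / 4" "l + artanh r < c - s" using step.prems(1,2) s by (auto simp: s_def)
    fix z m assume "disc_chain \<Omega> (f w) z m" "m < c - s"
    then show "z \<in> U"
      using step.prems(3)[OF disc_chain.step[OF step.hyps(1,2)], of z m] by (simp add: s_def)
  qed
  then obtain m where m: "m \<le> (4 / r) * l" "disc_chain (U \<inter> \<Omega>) (f w) y m" by blast
  define g where "g z = f (of_real r * z)" for z
  have rz: "cmod (of_real r * z) < r" if "z \<in> ball 0 1" for z
    using that r by (simp add: norm_mult)
  have "holomorphic_disc \<Omega> g"
    unfolding g_def using r rz
    by (intro holomorphic_disc_compose[OF step.hyps(1)] holomorphic_intros) (fastforce simp: image_subset_iff)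
  moreover have "g z \<in> U" if z: "z \<in> ball 0 1" for z
  proof -
    have "disc_chain \<Omega> (f 0) (g z) (artanh (cmod (of_real r * z)))"
      unfolding g_def using rz[OF z] r by (intro disc_chain_disc step.hyps(1)) simp
    moreover have "artanh (cmod (of_real r * z)) \<le> artanh r"
      using rz[OF z] r by (intro artanh_mono) auto
    ultimately show ?thesis
      using step.prems(2,3) s by (smt (verit) s_def)
  qed
  ultimately have g: "holomorphic_disc (U \<inter> \<Omega>) g" by (auto simp: holomorphic_disc_def)
  have w: "cmod w \<le> r / 2" using step.prems(1) s by (simp add: s_def)
  have "cmod (w / of_real r) < 1" using w r by (simp add: norm_divide field_simps)
  moreover have "g (w / of_real r) = f w" "g 0 = f 0" using r by (auto simp: g_def)
  ultimately have "disc_chain (U \<inter> \<Omega>) (f 0) y (artanh (cmod (w / of_real r)) + m)"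
    using disc_chain.step[OF g, of "w / of_real r" y m] m(2) by simp
  moreover have "artanh (cmod (w / of_real r)) \<le> (4 / r) * s"
  proof -
    have "artanh (cmod (w / of_real r)) \<le> 2 * cmod (w / of_real r)"
      using w r by (intro artanh_le_double) (auto simp: norm_divide field_simps)
    also have "\<dots> = (4 / r) * (cmod w / 2)" using r by (simp add: norm_divide)
    also have "\<dots> \<le> (4 / r) * s" using s r by (intro mult_left_mono) auto
    finally show ?thesis .
  qed
  ultimately show ?case
    using m(1) by (intro exI[of _ "artanh (cmod (w / of_real r)) + m"]) (simp add: s_def ring_distribs)
qed

text \<open>Localize a chain in \<open>\<Omega>\<close> of nearly minimal length. The premise on \<open>x\<close> says that \<open>x\<close> has Kobayashi
  distance at least \<open>c\<close> from \<open>\<Omega> - U\<close>.\<close>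

lemma kobayashi_dist_localization:
  assumes "open \<Omega>" "connected \<Omega>" and c: "0 < c"
  obtains L \<eta> where "0 \<le> L" "0 < \<eta>"
    "\<And>x y. \<lbrakk>x \<in> \<Omega>; y \<in> \<Omega>; \<And>z m. \<lbrakk>disc_chain \<Omega> x z m; m < c\<rbrakk> \<Longrightarrow> z \<in> U; kobayashi_dist \<Omega> x y < \<eta>\<rbrakk>
      \<Longrightarrow> kobayashi_dist (U \<inter> \<Omega>) x y \<le> L * kobayashi_dist \<Omega> x y"
proof -
  define r where "r = min (1 / 2) (c / 4)"
  have r: "0 < r" "r < 1" "r \<le> 1 / 2" "r \<le> c / 4" using c by (auto simp: r_def)
  have rc: "r / 4 + artanh r < c" using artanh_le_double[of r] r c by simp
  show thesis
  proof (rule that[of "4 / r" "r / 4"])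
    fix x y assume xy: "x \<in> \<Omega>" "y \<in> \<Omega>" and U: "\<And>z m. \<lbrakk>disc_chain \<Omega> x z m; m < c\<rbrakk> \<Longrightarrow> z \<in> U"
      and small: "kobayashi_dist \<Omega> x y < r / 4"
    have "x \<in> U" using U[OF disc_chain.refl] c by simp
    have "(r / 4) * kobayashi_dist (U \<inter> \<Omega>) x y \<le> kobayashi_dist \<Omega> x y"
    proof (rule field_le_epsilon)
      fix e :: real assume "0 < e"
      then have "kobayashi_dist \<Omega> x y < min (r / 4) (kobayashi_dist \<Omega> x y + e)" using small by simp
      then obtain l where l: "disc_chain \<Omega> x y l" "l < min (r / 4) (kobayashi_dist \<Omega> x y + e)"
        by (rule disc_chain_approximates[OF assms(1,2) xy])
      have "l \<le> r / 4" "l + artanh r < c" using l(2) rc by auto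
      then have "\<exists>m \<le> (4 / r) * l. disc_chain (U \<inter> \<Omega>) x y m"
        by (rule disc_chain_localize[OF l(1) r(1,2)]) (rule U)
      then obtain m where m: "m \<le> (4 / r) * l" "disc_chain (U \<inter> \<Omega>) x y m" by blast
      have "kobayashi_dist (U \<inter> \<Omega>) x y \<le> m"
        using \<open>x \<in> U\<close> xy(1) by (intro kobayashi_dist_le_disc_chain[OF m(2)]) simp
      then have "(r / 4) * kobayashi_dist (U \<inter> \<Omega>) x y \<le> (r / 4) * ((4 / r) * l)"
        using m(1) r by (intro mult_left_mono) auto
      also have "\<dots> = l" using r by simp
      finally show "(r / 4) * kobayashi_dist (U \<inter> \<Omega>) x y \<le> kobayashi_dist \<Omega> x y + e"
        using l(2) by simp
    qed
    then show "kobayashi_dist (U \<inter> \<Omega>) x y \<le> 4 / r * kobayashi_dist \<Omega> x y"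
      using r(1) by (simp add: field_simps)
  qed (use r in auto)
qed

text \<open>Otherwise there are times \<open>t n \<ge> n\<close> and points \<open>q n\<close> on a fixed small sphere around \<open>\<xi>\<close> with
  Kobayashi distance less than \<open>1 / (n + 1)\<close> from \<open>\<gamma> (t n)\<close>. Let \<open>z\<close> be a limit point of the \<open>q n\<close>.
  If \<open>z \<in> \<Omega>\<close>, then \<open>\<gamma> (t n)\<close> stays at bounded distance from \<open>z\<close> along a subsequence, although
  \<open>\<gamma>\<close> is a geodesic ray. If \<open>z\<close> is a boundary point, then \<open>\<xi> \<noteq> z\<close> contradicts the hyperbolic
  embedding.\<close>

lemma landing_ray_deep_in_neighbourhood:
  assumes dom: "complex_domain \<Omega>" and hyp: "kobayashi_hyperbolic \<Omega>"
    and emb: "hyperbolically_embedded \<Omega>" and \<xi>: "\<xi> \<in> frontier \<Omega>"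
    and ray: "geodesic_ray \<Omega> (kobayashi_dist \<Omega>) \<gamma>" and lands: "(\<gamma> \<longlongrightarrow> \<xi>) at_top"
    and U: "open U" "\<xi> \<in> U"
  obtains T c where "0 \<le> T" "0 < c"
    "\<And>t z l. \<lbrakk>T \<le> t; disc_chain \<Omega> (\<gamma> t) z l; l < c\<rbrakk> \<Longrightarrow> z \<in> U"
proof -
  interpret Metric_space \<Omega> "kobayashi_dist \<Omega>" using hyp by (simp add: kobayashi_hyperbolic_def)
  have op: "open \<Omega>" using dom by (simp add: complex_domain_def)
  have \<gamma>: "\<gamma> t \<in> \<Omega>" if "0 \<le> t" for t using ray that by (auto simp: geodesic_ray_def)
  obtain r where r: "0 < r" "ball \<xi> r \<subseteq> U" using U by (meson openE)
  have "\<forall>\<^sub>F t in at_top. dist (\<gamma> t) \<xi> < r" using tendstoD[OF lands r(1)] .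
  then obtain T0 where T0: "\<And>t. T0 \<le> t \<Longrightarrow> dist \<xi> (\<gamma> t) < r"
    by (auto simp: eventually_at_top_linorder dist_commute)
  have "\<exists>T\<ge>0. \<exists>c>0. \<forall>t\<ge>T. \<forall>z l. disc_chain \<Omega> (\<gamma> t) z l \<longrightarrow> l < c \<longrightarrow> z \<in> U"
  proof (rule ccontr)
    assume neg: "\<not> ?thesis"
    have "\<exists>t q. real n \<le> t \<and> q \<in> \<Omega> \<and> dist \<xi> q = r \<and> kobayashi_dist \<Omega> (\<gamma> t) q < inverse (real (Suc n))"
      for n
    proof -
      have "0 \<le> max (real n) T0" "0 < inverse (real (Suc n))" by auto
      then obtain t z l where t: "max (real n) T0 \<le> t" "disc_chain \<Omega> (\<gamma> t) z l"
          "l < inverse (real (Suc n))" "z \<notin> U"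
        using neg by blast
      have "r \<le> dist \<xi> z" using r(2) t(4) by (auto simp: subset_iff not_less)
      then obtain q l' where q: "disc_chain \<Omega> (\<gamma> t) q l'" "l' \<le> l" "dist \<xi> q = r"
        using disc_chain_crosses_sphere[OF t(2) T0] t(1) by (metis max.bounded_iff)
      have t0: "0 \<le> t" using t(1) by (smt (verit) max.bounded_iff of_nat_0_le_iff)
      show ?thesis
        using t q kobayashi_dist_le_disc_chain[OF q(1) \<gamma>[OF t0]] disc_chain_in[OF q(1) \<gamma>[OF t0]]
        by (intro exI[of _ t] exI[of _ q]) auto
    qed
    then have "\<forall>n. \<exists>tq. real n \<le> fst tq \<and> snd tq \<in> \<Omega> \<and> dist \<xi> (snd tq) = r \<and>
        kobayashi_dist \<Omega> (\<gamma> (fst tq)) (snd tq) < inverse (real (Suc n))" by (simp add: split_paired_Ex)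
    from choice[OF this] obtain tq where tq: "\<And>n. real n \<le> fst (tq n)" "\<And>n. snd (tq n) \<in> \<Omega>"
      "\<And>n. dist \<xi> (snd (tq n)) = r"
      "\<And>n. kobayashi_dist \<Omega> (\<gamma> (fst (tq n))) (snd (tq n)) < inverse (real (Suc n))"
      by blast
    define t where "t n = fst (tq n)" for n
    define q where "q n = snd (tq n)" for n
    have t: "real n \<le> t n" "0 \<le> t n" and q: "q n \<in> \<Omega>" "dist \<xi> (q n) = r"
      and tq': "kobayashi_dist \<Omega> (\<gamma> (t n)) (q n) < inverse (real (Suc n))" for n
      using tq[of n] by (auto simp: t_def q_def intro: order_trans[OF of_nat_0_le_iff])
    have "compact (sphere \<xi> r)" by simp
    then obtain z s where z: "z \<in> sphere \<xi> r" and s: "strict_mono (s :: nat \<Rightarrow> nat)"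
      and lim: "(q \<circ> s) \<longlonglongrightarrow> z"
      using q(2) unfolding compact_def by (metis mem_sphere)
    have t_s: "filterlim (\<lambda>n. t (s n)) at_top sequentially"
    proof (rule filterlim_at_top_mono[OF filterlim_real_sequentially])
      have "real n \<le> t (s n)" for n
        using t(1)[of "s n"] seq_suble[OF s, of n] by (meson of_nat_mono order_trans)
      then show "\<forall>\<^sub>F n in sequentially. real n \<le> t (s n)" by simp
    qed
    have k_s: "(\<lambda>n. kobayashi_dist \<Omega> (\<gamma> (t (s n))) (q (s n))) \<longlonglongrightarrow> 0"
    proof (rule tendsto_sandwich[OF _ _ tendsto_const LIMSEQ_inverse_real_of_nat])
      have "inverse (real (Suc (s n))) \<le> inverse (real (Suc n))" for n
        using seq_suble[OF s, of n] by (intro le_imp_inverse_le) auto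
      then have "kobayashi_dist \<Omega> (\<gamma> (t (s n))) (q (s n)) \<le> inverse (real (Suc n))" for n
        using tq'[of "s n"] by (meson less_imp_le order_trans)
      then show "\<forall>\<^sub>F n in sequentially. kobayashi_dist \<Omega> (\<gamma> (t (s n))) (q (s n)) \<le> inverse (real (Suc n))"
        by simp
    qed simp
    show False
    proof (cases "z \<in> \<Omega>")
      case True
      have "(\<lambda>n. kobayashi_dist \<Omega> z ((q \<circ> s) n)) \<longlonglongrightarrow> 0"
        by (rule kobayashi_dist_tendsto_0[OF hyp op True lim])
      from tendsto_add[OF k_s this]
      have "(\<lambda>n. kobayashi_dist \<Omega> (\<gamma> (t (s n))) (q (s n)) + kobayashi_dist \<Omega> z (q (s n))) \<longlonglongrightarrow> 0"
        by simp
      then have "\<forall>\<^sub>F n in sequentially.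
          kobayashi_dist \<Omega> (\<gamma> (t (s n))) (q (s n)) + kobayashi_dist \<Omega> z (q (s n)) < 1"
        by (rule order_tendstoD) simp
      moreover have "\<forall>\<^sub>F n in sequentially. kobayashi_dist \<Omega> (\<gamma> 0) z + 1 \<le> t (s n)"
        using t_s unfolding filterlim_at_top by blast
      ultimately have "\<forall>\<^sub>F n in sequentially. False"
      proof eventually_elim
        case (elim n)
        have "t (s n) = kobayashi_dist \<Omega> (\<gamma> 0) (\<gamma> (t (s n)))"
          using ray t(2)[of "s n"] by (auto simp: geodesic_ray_def)
        also have "\<dots> \<le> kobayashi_dist \<Omega> (\<gamma> 0) z + kobayashi_dist \<Omega> z (\<gamma> (t (s n)))"
          using triangle \<gamma> t(2) True by simp
        also have "kobayashi_dist \<Omega> z (\<gamma> (t (s n)))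
            \<le> kobayashi_dist \<Omega> z (q (s n)) + kobayashi_dist \<Omega> (\<gamma> (t (s n))) (q (s n))"
          using triangle' \<gamma> t(2) q(1) True by simp
        finally show False using elim by linarith
      qed
      then show False by simp
    next
      case False
      have "z \<in> closure \<Omega>"
        unfolding closure_sequential using lim q(1) by (intro exI[of _ "q \<circ> s"]) auto
      then have zf: "z \<in> frontier \<Omega>" using False op by (simp add: frontier_def interior_open)
      have "\<xi> \<noteq> z" using z r(1) by auto
      have \<xi>\<Omega>: "\<xi> \<notin> \<Omega>" using \<xi> op by (simp add: frontier_def interior_open)
      have "0 < Liminf (at (\<xi>, z) within \<Omega> \<times> \<Omega>) (\<lambda>(x, y). ereal (kobayashi_dist \<Omega> x y))"
        using emb \<xi> zf \<open>\<xi> \<noteq> z\<close> unfolding hyperbolically_embedded_def by blast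
      then obtain e where e: "0 < e" "e < Liminf (at (\<xi>, z) within \<Omega> \<times> \<Omega>) (\<lambda>(x, y). ereal (kobayashi_dist \<Omega> x y))"
        using dense by blast
      have ev: "\<forall>\<^sub>F p in at (\<xi>, z) within \<Omega> \<times> \<Omega>. e < (case p of (x, y) \<Rightarrow> ereal (kobayashi_dist \<Omega> x y))"
        by (rule less_LiminfD[OF e(2)])
      have "filterlim (\<lambda>n. (\<gamma> (t (s n)), q (s n))) (at (\<xi>, z) within \<Omega> \<times> \<Omega>) sequentially"
        unfolding filterlim_at
      proof
        have "(\<lambda>n. \<gamma> (t (s n))) \<longlonglongrightarrow> \<xi>" by (rule filterlim_compose[OF lands t_s])
        then show "(\<lambda>n. (\<gamma> (t (s n)), q (s n))) \<longlonglongrightarrow> (\<xi>, z)"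
          using lim by (intro tendsto_Pair) (simp_all add: o_def)
        show "\<forall>\<^sub>F n in sequentially. (\<gamma> (t (s n)), q (s n)) \<in> \<Omega> \<times> \<Omega> \<and> (\<gamma> (t (s n)), q (s n)) \<noteq> (\<xi>, z)"
          using \<gamma> t(2) q(1) \<xi>\<Omega> by (intro always_eventually) auto
      qed
      from eventually_compose_filterlim[OF ev this]
      have "\<forall>\<^sub>F n in sequentially. e \<le> ereal (kobayashi_dist \<Omega> (\<gamma> (t (s n))) (q (s n)))"
        by (auto elim: eventually_mono)
      moreover have "(\<lambda>n. ereal (kobayashi_dist \<Omega> (\<gamma> (t (s n))) (q (s n)))) \<longlonglongrightarrow> ereal 0"
        using k_s by (simp only: lim_ereal)
      ultimately have "e \<le> ereal 0" by (intro tendsto_lowerbound) auto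
      with e(1) show False by (simp add: zero_ereal_def)
    qed
  qed
  then show thesis using that by blast
qed


section \<open>Geodesic rays landing at a common point\<close>

lemma (in Metric_space) Lipschitz_if_locally_Lipschitz:
  assumes path: "\<And>t. 0 \<le> t \<Longrightarrow> \<alpha> t \<in> M" and \<eta>: "0 < \<eta>"
    and local: "\<And>s t. \<lbrakk>0 \<le> s; 0 \<le> t; \<bar>s - t\<bar> < \<eta>\<rbrakk> \<Longrightarrow> d (\<alpha> s) (\<alpha> t) \<le> L * \<bar>s - t\<bar>"
    and "0 \<le> s" "0 \<le> t"
  shows "d (\<alpha> s) (\<alpha> t) \<le> L * \<bar>s - t\<bar>"
proof -
  have forward: "d (\<alpha> s) (\<alpha> t) \<le> L * (t - s)" if "0 \<le> s" "s \<le> t" "t - s \<le> real n * (\<eta> / 2)" for n s t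
    using that
  proof (induction n arbitrary: t)
    case 0
    then have "t = s" by simp
    then show ?case using 0 path by simp
  next
    case (Suc n)
    show ?case
    proof (cases "t - s < \<eta>")
      case True
      then show ?thesis using local[of s t] Suc.prems by simp
    next
      case False
      define u where "u = t - \<eta> / 2"
      have u: "s \<le> u" "0 \<le> u" "u - s \<le> real n * (\<eta> / 2)" "\<bar>u - t\<bar> < \<eta>"
        using False \<eta> Suc.prems by (auto simp: u_def ring_distribs)
      have "d (\<alpha> s) (\<alpha> t) \<le> d (\<alpha> s) (\<alpha> u) + d (\<alpha> u) (\<alpha> t)"
        using triangle path u Suc.prems by simp
      also have "\<dots> \<le> L * (u - s) + L * \<bar>u - t\<bar>"
        using Suc.IH[OF Suc.prems(1) u(1,3)] local[of u t] u Suc.prems by simp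
      also have "\<dots> = L * (t - s)" using \<eta> by (simp add: u_def ring_distribs)
      finally show ?thesis .
    qed
  qed
  have *: "d (\<alpha> s) (\<alpha> t) \<le> L * (t - s)" if "0 \<le> s" "s \<le> t" for s t
  proof -
    obtain n :: nat where "(t - s) / (\<eta> / 2) \<le> real n" using real_arch_simple by blast
    then have "t - s \<le> real n * (\<eta> / 2)" using \<eta> by (simp add: field_simps)
    then show ?thesis using forward that by blast
  qed
  show ?thesis
    using *[of s t] *[of t s] assms(4,5) by (cases "s \<le> t") (auto simp: commute)
qed

text \<open>Times \<open>t\<close> and \<open>s\<close> at which two geodesic rays are close differ by a bounded amount, since they are
  the distances to the origins of the rays.\<close>

lemma (in Metric_space) rays_asymptotic_if_close:
  assumes \<gamma>: "geodesic_ray M d \<gamma>" and \<sigma>: "geodesic_ray M d \<sigma>" and T: "0 \<le> T"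
    and close: "\<And>t. T \<le> t \<Longrightarrow> \<exists>s\<ge>0. d (\<gamma> t) (\<sigma> s) \<le> C"
  shows "bdd_above ((\<lambda>t. d (\<gamma> t) (\<sigma> t)) ` {0..})"
proof -
  define D where "D = d (\<gamma> 0) (\<sigma> 0)"
  have M: "\<gamma> t \<in> M" "\<sigma> t \<in> M" if "0 \<le> t" for t
    using \<gamma> \<sigma> that by (auto simp: geodesic_ray_def)
  have g: "d (\<gamma> s) (\<gamma> t) = \<bar>s - t\<bar>" "d (\<sigma> s) (\<sigma> t) = \<bar>s - t\<bar>" if "0 \<le> s" "0 \<le> t" for s t
    using \<gamma> \<sigma> that by (auto simp: geodesic_ray_def)
  have "d (\<gamma> t) (\<sigma> t) \<le> max (2 * T + D) (2 * C + D)" if t: "0 \<le> t" for t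
  proof (cases "T \<le> t")
    case True
    then obtain s where s: "0 \<le> s" "d (\<gamma> t) (\<sigma> s) \<le> C" using close by blast
    have "t \<le> D + s + C" "s \<le> D + t + C"
      using triangle[OF M(1) M(2) M(1), of 0 0 t] triangle'[OF M(2) M(2) M(1), of 0 s t]
        triangle''[OF M(2) M(1) M(2), of 0 0 s] triangle[OF M(1) M(1) M(2), of 0 t s]
        g[of 0 t] g[of 0 s] s t by (auto simp: D_def)
    then have "\<bar>s - t\<bar> \<le> C + D" by simp
    moreover have "d (\<gamma> t) (\<sigma> t) \<le> d (\<gamma> t) (\<sigma> s) + d (\<sigma> s) (\<sigma> t)"
      using triangle M t s by simp
    ultimately show ?thesis using g(2)[OF s(1) t] s(2) by simp
  next
    case False
    have "d (\<gamma> t) (\<sigma> t) \<le> d (\<gamma> t) (\<gamma> 0) + (d (\<gamma> 0) (\<sigma> 0) + d (\<sigma> 0) (\<sigma> t))"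
      using triangle[OF M(1) M(1) M(2), of t 0 t] triangle[OF M(1) M(2) M(2), of 0 0 t] t by simp
    then show ?thesis using g[of t 0] g[of 0 t] t False by (simp add: D_def)
  qed
  then show ?thesis by (intro bdd_aboveI2[where M = "max (2 * T + D) (2 * C + D)"]) simp
qed

text \<open>The upper bound holds at small scale by localization, and a path inherits it at all scales. The
  lower bound is the monotonicity \<open>k\<^sub>\<Omega> \<le> k\<^sub>X\<close>.\<close>

lemma landing_ray_quasigeodesic:
  assumes dom: "complex_domain \<Omega>" and hyp: "kobayashi_hyperbolic \<Omega>"
    and emb: "hyperbolically_embedded \<Omega>" and \<xi>: "\<xi> \<in> frontier \<Omega>"
    and ray: "geodesic_ray \<Omega> (kobayashi_dist \<Omega>) \<gamma>" and lands: "(\<gamma> \<longlongrightarrow> \<xi>) at_top"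
    and U: "open U" "\<xi> \<in> U" and UO: "connected (U \<inter> \<Omega>)" "kobayashi_hyperbolic (U \<inter> \<Omega>)"
  obtains T L where "0 \<le> T" "0 \<le> L" "\<And>t. 0 \<le> t \<Longrightarrow> \<gamma> (T + t) \<in> U \<inter> \<Omega>"
    "\<And>s t. \<lbrakk>0 \<le> s; 0 \<le> t\<rbrakk> \<Longrightarrow> kobayashi_dist (U \<inter> \<Omega>) (\<gamma> (T + s)) (\<gamma> (T + t)) \<le> L * \<bar>s - t\<bar>"
    "\<And>s t. \<lbrakk>0 \<le> s; 0 \<le> t\<rbrakk> \<Longrightarrow> \<bar>s - t\<bar> \<le> kobayashi_dist (U \<inter> \<Omega>) (\<gamma> (T + s)) (\<gamma> (T + t))"
proof -
  have op: "open \<Omega>" "connected \<Omega>" using dom by (auto simp: complex_domain_def)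
  have \<gamma>: "\<gamma> t \<in> \<Omega>" if "0 \<le> t" for t using ray that by (auto simp: geodesic_ray_def)
  obtain T c where T: "0 \<le> T" and c: "0 < c"
    and deep: "\<And>t z l. \<lbrakk>T \<le> t; disc_chain \<Omega> (\<gamma> t) z l; l < c\<rbrakk> \<Longrightarrow> z \<in> U"
    using landing_ray_deep_in_neighbourhood[OF dom hyp emb \<xi> ray lands U] by metis
  obtain L \<eta> where L: "0 \<le> L" "0 < \<eta>"
    and loc: "\<And>x y. \<lbrakk>x \<in> \<Omega>; y \<in> \<Omega>; \<And>z m. \<lbrakk>disc_chain \<Omega> x z m; m < c\<rbrakk> \<Longrightarrow> z \<in> U; kobayashi_dist \<Omega> x y < \<eta>\<rbrakk>
      \<Longrightarrow> kobayashi_dist (U \<inter> \<Omega>) x y \<le> L * kobayashi_dist \<Omega> x y"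
    by (rule kobayashi_dist_localization[OF op c, where U = U]) blast
  define \<alpha> where "\<alpha> t = \<gamma> (T + t)" for t
  have \<alpha>: "\<alpha> t \<in> U \<inter> \<Omega>" if "0 \<le> t" for t
    using deep[of "T + t", OF _ disc_chain.refl c] \<gamma>[of "T + t"] that T by (auto simp: \<alpha>_def)
  have k: "kobayashi_dist \<Omega> (\<alpha> s) (\<alpha> t) = \<bar>s - t\<bar>" if "0 \<le> s" "0 \<le> t" for s t
    using ray that T by (auto simp: geodesic_ray_def \<alpha>_def)
  interpret Metric_space "U \<inter> \<Omega>" "kobayashi_dist (U \<inter> \<Omega>)"
    using UO(2) by (simp add: kobayashi_hyperbolic_def)
  have local: "kobayashi_dist (U \<inter> \<Omega>) (\<alpha> s) (\<alpha> t) \<le> L * \<bar>s - t\<bar>"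
    if "0 \<le> s" "0 \<le> t" "\<bar>s - t\<bar> < \<eta>" for s t
  proof -
    have "kobayashi_dist (U \<inter> \<Omega>) (\<alpha> s) (\<alpha> t) \<le> L * kobayashi_dist \<Omega> (\<alpha> s) (\<alpha> t)"
    proof (rule loc)
      fix z m assume "disc_chain \<Omega> (\<alpha> s) z m" "m < c"
      then show "z \<in> U" using deep[of "T + s"] that(1) by (simp add: \<alpha>_def)
    qed (use \<alpha> k that in auto)
    then show ?thesis using k that by simp
  qed
  show thesis
  proof (rule that[OF T L(1)])
    fix s t :: real assume st: "0 \<le> s" "0 \<le> t"
    show "kobayashi_dist (U \<inter> \<Omega>) (\<gamma> (T + s)) (\<gamma> (T + t)) \<le> L * \<bar>s - t\<bar>"
      using Lipschitz_if_locally_Lipschitz[OF \<alpha> L(2) local st] by (simp add: \<alpha>_def)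
    have "open (U \<inter> \<Omega>)" using U(1) op(1) by (rule open_Int)
    from kobayashi_dist_antimono[OF this UO(1) Int_lower2 \<alpha>[OF st(1)] \<alpha>[OF st(2)]]
    show "\<bar>s - t\<bar> \<le> kobayashi_dist (U \<inter> \<Omega>) (\<gamma> (T + s)) (\<gamma> (T + t))"
      using k[OF st] by (simp add: \<alpha>_def)
  next
    show "\<gamma> (T + t) \<in> U \<inter> \<Omega>" if "0 \<le> t" for t
      using \<alpha>[OF that] by (simp add: \<alpha>_def)
  qed
qed

lemma kobayashi_gromov_hyperbolic_model:
  fixes X :: "(complex ^ 'n) set"
  assumes op: "open X" "X \<noteq> {}" "bounded X" and hyp: "kobayashi_hyperbolic X"
    and homeo: "homeomorphic_map (gromov_compactification X (kobayashi_dist X)) (top_of_set (closure X)) \<Phi>"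
    and Phi: "\<And>x. x \<in> X \<Longrightarrow> \<Phi> (Inl x) = x"
    and grom: "gromov_hyperbolic X (kobayashi_dist X)"
  shows "\<exists>\<delta>. gromov_hyperbolic_model X (kobayashi_dist X) \<Phi> \<delta>"
proof -
  interpret Metric_space X "kobayashi_dist X" using hyp by (simp add: kobayashi_hyperbolic_def)
  obtain \<delta> where \<delta>: "0 \<le> \<delta>" "\<forall>p\<in>X. \<forall>x\<in>X. \<forall>y\<in>X. \<forall>z\<in>X.
      min (gromov_product (kobayashi_dist X) p x y) (gromov_product (kobayashi_dist X) p y z) - \<delta>
        \<le> gromov_product (kobayashi_dist X) p x z"
    using grom unfolding gromov_hyperbolic_def by blast
  have "closure X \<noteq> X"
  proof
    assume "closure X = X"
    then have "closed X" by (simp add: closure_eq)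
    then have "X = UNIV" using clopen op by blast
    then show False using op(3) not_bounded_UNIV by metis
  qed
  then have "gromov_hyperbolic_model X (kobayashi_dist X) \<Phi> \<delta>"
    by unfold_locales
      (use homeo Phi op(3) \<delta> kobayashi_dist_tendsto_0[OF hyp op(1)] in auto)
  then show ?thesis by blast
qed

theorem proposition1p3:
  fixes \<Omega> :: "(complex ^ 'd) set" and \<xi> :: "complex ^ 'd"
    and \<gamma> \<sigma> :: "real \<Rightarrow> complex ^ 'd"
  assumes "local_gromov_model_domain \<Omega>"
    and "hyperbolically_embedded \<Omega>"
    and "\<xi> \<in> frontier \<Omega>"
    and "geodesic_ray \<Omega> (kobayashi_dist \<Omega>) \<gamma>"
    and "geodesic_ray \<Omega> (kobayashi_dist \<Omega>) \<sigma>"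
    and "(\<gamma> \<longlongrightarrow> \<xi>) at_top"
    and "(\<sigma> \<longlongrightarrow> \<xi>) at_top"
  shows "bdd_above ((\<lambda>t. kobayashi_dist \<Omega> (\<gamma> t) (\<sigma> t)) ` {0..})"
proof -
  have dom: "complex_domain \<Omega>" and hyp: "kobayashi_hyperbolic \<Omega>"
    using assms(1) by (auto simp: local_gromov_model_domain_def)
  obtain U \<Phi> where U: "open U" "bounded U" "\<xi> \<in> U" and conn: "connected (U \<inter> \<Omega>)"
    and complete: "complete_kobayashi_hyperbolic (U \<inter> \<Omega>)"
    and grom: "gromov_hyperbolic (U \<inter> \<Omega>) (kobayashi_dist (U \<inter> \<Omega>))"
    and homeo: "homeomorphic_map (gromov_compactification (U \<inter> \<Omega>) (kobayashi_dist (U \<inter> \<Omega>)))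
        (top_of_set (closure (U \<inter> \<Omega>))) \<Phi>"
    and Phi: "\<forall>x\<in>U \<inter> \<Omega>. \<Phi> (Inl x) = x"
    using assms(1,3) unfolding local_gromov_model_domain_def by blast
  have hypU: "kobayashi_hyperbolic (U \<inter> \<Omega>)"
    using complete by (simp add: complete_kobayashi_hyperbolic_def)
  have op: "open \<Omega>" "open (U \<inter> \<Omega>)" using dom U(1) by (auto simp: complex_domain_def)
  obtain T L where T: "0 \<le> T" "0 \<le> L" "\<And>t. 0 \<le> t \<Longrightarrow> \<gamma> (T + t) \<in> U \<inter> \<Omega>"
    "\<And>s t. \<lbrakk>0 \<le> s; 0 \<le> t\<rbrakk> \<Longrightarrow> kobayashi_dist (U \<inter> \<Omega>) (\<gamma> (T + s)) (\<gamma> (T + t)) \<le> L * \<bar>s - t\<bar>"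
    "\<And>s t. \<lbrakk>0 \<le> s; 0 \<le> t\<rbrakk> \<Longrightarrow> \<bar>s - t\<bar> \<le> kobayashi_dist (U \<inter> \<Omega>) (\<gamma> (T + s)) (\<gamma> (T + t))"
    by (rule landing_ray_quasigeodesic[OF dom hyp assms(2-4,6) U(1,3) conn hypU]) blast
  obtain S K where S: "0 \<le> S" "0 \<le> K" "\<And>t. 0 \<le> t \<Longrightarrow> \<sigma> (S + t) \<in> U \<inter> \<Omega>"
    "\<And>s t. \<lbrakk>0 \<le> s; 0 \<le> t\<rbrakk> \<Longrightarrow> kobayashi_dist (U \<inter> \<Omega>) (\<sigma> (S + s)) (\<sigma> (S + t)) \<le> K * \<bar>s - t\<bar>"
    "\<And>s t. \<lbrakk>0 \<le> s; 0 \<le> t\<rbrakk> \<Longrightarrow> \<bar>s - t\<bar> \<le> kobayashi_dist (U \<inter> \<Omega>) (\<sigma> (S + s)) (\<sigma> (S + t))"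
    by (rule landing_ray_quasigeodesic[OF dom hyp assms(2,3,5,7) U(1,3) conn hypU]) blast
  have "U \<inter> \<Omega> \<noteq> {}" using T(3)[of 0] by auto
  moreover have "bounded (U \<inter> \<Omega>)" using U(2) by (rule bounded_Int[OF disjI1])
  ultimately obtain \<delta> where
    "gromov_hyperbolic_model (U \<inter> \<Omega>) (kobayashi_dist (U \<inter> \<Omega>)) \<Phi> \<delta>"
    using kobayashi_gromov_hyperbolic_model[OF op(2) _ _ hypU homeo _ grom] Phi by blast
  then interpret model: gromov_hyperbolic_model "U \<inter> \<Omega>" "kobayashi_dist (U \<inter> \<Omega>)" \<Phi> \<delta> .
  have lands: "((\<lambda>t. \<gamma> (T + t)) \<longlongrightarrow> \<xi>) at_top" "((\<lambda>t. \<sigma> (S + t)) \<longlongrightarrow> \<xi>) at_top"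
    by (rule filterlim_compose[OF assms(6)] filterlim_compose[OF assms(7)],
      rule filterlim_tendsto_add_at_top[OF tendsto_const filterlim_ident])+
  obtain C where C: "\<And>t. 0 \<le> t \<Longrightarrow> \<exists>s\<ge>0. kobayashi_dist (U \<inter> \<Omega>) (\<gamma> (T + t)) (\<sigma> (S + s)) \<le> C"
    using model.quasigeodesics_landing_together_close
      [OF T(3-5,2) lands(1) S(3-5,2) lands(2)] by auto
  interpret Metric_space \<Omega> "kobayashi_dist \<Omega>" using hyp by (simp add: kobayashi_hyperbolic_def)
  show ?thesis
  proof (rule rays_asymptotic_if_close[OF assms(4,5) T(1)])
    fix t assume "T \<le> t"
    then obtain s where s: "0 \<le> s" "kobayashi_dist (U \<inter> \<Omega>) (\<gamma> t) (\<sigma> (S + s)) \<le> C"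
      using C[of "t - T"] by auto
    have "\<gamma> t \<in> U \<inter> \<Omega>" using T(3)[of "t - T"] \<open>T \<le> t\<close> by simp
    from kobayashi_dist_antimono[OF op(2) conn Int_lower2 this S(3)[OF s(1)]]
    show "\<exists>s\<ge>0. kobayashi_dist \<Omega> (\<gamma> t) (\<sigma> s) \<le> C"
      using s S(1) by (intro exI[of _ "S + s"]) simp
  qed
qed

end
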